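(* Consider the Poisson torus with coordinate ring $\mathbb C[c_0^{\pm1},d_0^{\pm1},\dots,c_n^{\pm1},d_n^{\pm1}]$, which is obtained as a reduction of both the Coxeter–Toda phase space $(\widetilde{LSL}_{n+1})_{\mathbf i}$ and the phase space of the relativistic periodic Toda system with $h=2$; that is, there are surjective Poisson maps from these two phase spaces onto the torus, given respectively by $$c_i\mapsto S_iT_iT_{i-1}^{-1},\quad d_i\mapsto T_iT_{i-1}^{-1}\qquad\text{and}\qquad c_i\mapsto 4e^{2p_i-q_i+q_{i+1}},\quad d_i\mapsto e^{2p_i}.$$ The Hamiltonian $$H_1=\sum_{i=0}^n (c_i+d_i)$$ on the torus pulls back to the Hamiltonians of the relativistic Toda and Coxeter–Toda systems under these maps, hence defines a Hamiltonian system which is a common reduction of these two integrable systems.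
   Context: Indices are read modulo $n+1$. Poisson torus: the brackets are $\{c_k,d_k\}=2c_kd_k$, $\{c_k,d_{k+1}\}=-2c_kd_{k+1}$, $\{c_k,c_{k+1}\}=-2c_kc_{k+1}$, all other brackets among the generators being zero. It is $(2n+2)$-dimensional with $2n$-dimensional symplectic leaves. Relativistic periodic Toda system: complex canonical coordinates $p_k,q_k$ ($\{p_j,q_k\}=\delta_{jk}$, other brackets zero), $k=0,\dots,n$, with $p_{k+n+1}=p_k$, $q_{k+n+1}=q_k$, and Hamiltonian $\sum_{k=0}^n e^{hp_k}(1+h^2\exp(q_{k+1}-q_k))$, here with $h=2$. Coxeter–Toda system of type $A_n^{(1)}$: $\widetilde{LSL}_{n+1}$ is the universal central extension by $\mathbb C^*$ of the loop group $SL_{n+1}(\mathbb C[z^{\pm1}])$, with simple affine roots $\alpha_0,\dots,\alpha_n$ (usual numbering), simple reflections $s_0,\dots,s_n$ and Cartan matrix $(C_{ij})$ of type $A_n^{(1)}$, carrying its standard Poisson–Lie structure. Let $\phi_i$ be the homomorphism from $SL_2$ onto the subgroup generated by the root subgroups of $\pm\alpha_i$. Consider the double Bruhat cell of $u=v=s_0s_1\cdots s_n$, i.e. the intersection of the double cosets of $u$ with respect to the positive Borel subgroup and of $v$ with respect to the negative Borel subgroup. Its dense subset $(\widetilde{LSL}_{n+1})_{\mathbf i}$ consists of the elements $$g=\phi_0(g_0)\cdots\phi_n(g_n)\,\phi_0(g_0')\cdots\phi_n(g_n'),\quad g_i=\begin{pmatrix}A_i&B_i\\0&A_i^{-1}\end{pmatrix},\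 g_i'=\begin{pmatrix}D_i^{-1}&0\\C_i&D_i\end{pmatrix},\ A_i,B_i,C_i,D_i\in\mathbb C^*.$$ On it one has the well-defined functions $$T_i=A_iD_i^{-1},\quad S_i=V_iW_i,\quad V_i=B_iD_i\prod_{k<i}D_k^{C_{ki}},\quad W_i=\Bigl(\prod_{k>i}A_k^{-C_{ki}}\Bigr)A_i^{-1}C_i,$$ where in the products $0\le k\le n$ and $<$ is the usual order on $\{0,\dots,n\}$. The Poisson structure is the one for which the factorization map is Poisson when the coordinates have nonzero brackets $\{B_i,A_i\}=A_iB_i$ and $\{D_i,C_i\}=C_iD_i$; the nonzero brackets among the $S_i,T_k$ are then $\{S_i,T_i\}=2S_iT_i$. The evaluation character of the defining representation is the function $\widetilde{LSL}_{n+1}\to\mathbb C[z^{\pm1}]$ sending an element to the trace of the matrix of Laurent polynomials of its image in $SL_{n+1}(\mathbb C[z^{\pm1}])$. The Coxeter–Toda system has as commuting Hamiltonians restrictions of coefficients of evaluation characters of representations of $SL_{n+1}$; the Coxeter–Toda Hamiltonian meant in the claim is the restriction of the constant ($z^0$) coefficient for the defining representation, which equals $\sum_{i=0}^n T_iT_{i-1}^{-1}(1+S_i)$.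
   Formalization: Neither map is onto the torus: the first forces ∏d_i=1, the second ∏c_i=4^{n+1}∏d_i. Surjectivity is replaced by surjectivity onto exactly these hypersurfaces, with ∏c_i, ∏d_i shown to be Casimirs. For n=1 the clashing brackets {c_0,c_1}, {c_1,c_0} are taken to cancel. *)

theory Defs
  imports
    "HOL-Analysis.Analysis"
    "HOL-Library.Poly_Mapping"
    "HOL-Algebra.Coset"
    "Jordan_Normal_Form.Determinant"
begin

section \<open>Poisson spaces, Poisson maps and Hamiltonian reductions\<close>

record 'x poisson_space =
  points :: "'x set"
  funs :: "('x \<Rightarrow> complex) set"
  bracket :: "('x \<Rightarrow> complex) \<Rightarrow> ('x \<Rightarrow> complex) \<Rightarrow> 'x \<Rightarrow> complex"

definition poisson_map :: "'x poisson_space \<Rightarrow> 'y poisson_space \<Rightarrow> ('x \<Rightarrow> 'y) \<Rightarrow> bool" where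
  "poisson_map M N F \<longleftrightarrow>
     F ` points M \<subseteq> points N \<and>
     (\<forall>f\<in>funs N. f \<circ> F \<in> funs M) \<and>
     (\<forall>f\<in>funs N. \<forall>g\<in>funs N. \<forall>x\<in>points M.
        bracket M (f \<circ> F) (g \<circ> F) x = bracket N f g (F x))"

definition casimir :: "'x poisson_space \<Rightarrow> ('x \<Rightarrow> complex) \<Rightarrow> bool" where
  "casimir N z \<longleftrightarrow> z \<in> funs N \<and> (\<forall>f\<in>funs N. \<forall>x\<in>points N. bracket N z f x = 0)"

text \<open>The map \<open>F\<close> reduces the Hamiltonian system \<open>(M, H)\<close> to \<open>(N, K)\<close>: it is Poisson, it pulls
  \<open>K\<close> back to \<open>H\<close>, and hence it intertwines the Hamiltonian vector fields.  Surjectivity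
  is not part of the definition: since \<open>\<Prod>i. T\<^sub>i / T\<^sub>i\<^sub>-\<^sub>1 = 1\<close> for cyclic indices (and similarly for the Toda
  system), neither of the two maps below is onto the full torus, and each has as its image a level set
  of a Casimir function.\<close>

definition hamiltonian_reduction ::
  "'x poisson_space \<Rightarrow> ('x \<Rightarrow> complex) \<Rightarrow> 'y poisson_space \<Rightarrow> ('y \<Rightarrow> complex) \<Rightarrow> ('x \<Rightarrow> 'y) \<Rightarrow> bool"
where
  "hamiltonian_reduction M H N K F \<longleftrightarrow>
     poisson_map M N F \<and> H \<in> funs M \<and> K \<in> funs N \<and>
     (\<forall>x\<in>points M. K (F x) = H x) \<and>
     (\<forall>f\<in>funs N. \<forall>x\<in>points M. bracket M H (f \<circ> F) x = bracket N K f (F x))"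

text \<open>Spaces with finitely many coordinates: a point is a function on the set \<open>I\<close> of coordinate
  labels (extensional, i.e. \<open>undefined\<close> outside \<open>I\<close>).  The bracket is the biderivation
  with prescribed values \<open>\<pi> a b\<close> on the coordinate functions.\<close>

definition pd :: "'l \<Rightarrow> (('l \<Rightarrow> complex) \<Rightarrow> complex) \<Rightarrow> ('l \<Rightarrow> complex) \<Rightarrow> complex" where
  "pd a f x = deriv (\<lambda>t. f (x(a := t))) (x a)"

definition coord_bracket ::
  "'l set \<Rightarrow> ('l \<Rightarrow> 'l \<Rightarrow> ('l \<Rightarrow> complex) \<Rightarrow> complex) \<Rightarrow>
   (('l \<Rightarrow> complex) \<Rightarrow> complex) \<Rightarrow> (('l \<Rightarrow> complex) \<Rightarrow> complex) \<Rightarrow> ('l \<Rightarrow> complex) \<Rightarrow> complex"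
where
  "coord_bracket I \<pi> f g x = (\<Sum>a\<in>I. \<Sum>b\<in>I. \<pi> a b x * pd a f x * pd b g x)"

inductive_set laurent_polys :: "'l set \<Rightarrow> (('l \<Rightarrow> complex) \<Rightarrow> complex) set" for I where
  const: "(\<lambda>x. r) \<in> laurent_polys I"
| coord: "a \<in> I \<Longrightarrow> (\<lambda>x. x a) \<in> laurent_polys I"
| coord_inv: "a \<in> I \<Longrightarrow> (\<lambda>x. inverse (x a)) \<in> laurent_polys I"
| add: "f \<in> laurent_polys I \<Longrightarrow> g \<in> laurent_polys I \<Longrightarrow> (\<lambda>x. f x + g x) \<in> laurent_polys I"
| mult: "f \<in> laurent_polys I \<Longrightarrow> g \<in> laurent_polys I \<Longrightarrow> (\<lambda>x. f x * g x) \<in> laurent_polys I"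

text \<open>The algebraic torus with coordinates \<open>I\<close> and brackets \<open>{x\<^sub>a, x\<^sub>b} = \<omega> a b x\<^sub>a x\<^sub>b\<close>.\<close>

definition log_canonical_torus :: "'l set \<Rightarrow> ('l \<Rightarrow> 'l \<Rightarrow> complex) \<Rightarrow> ('l \<Rightarrow> complex) poisson_space" where
  "log_canonical_torus I \<omega> =
    \<lparr>points = I \<rightarrow>\<^sub>E (- {0}),
     funs = {f. \<exists>g\<in>laurent_polys I. \<forall>x \<in> I \<rightarrow>\<^sub>E (- {0}). f x = g x},
     bracket = coord_bracket I (\<lambda>a b x. \<omega> a b * x a * x b)\<rparr>"


section \<open>The common reduction\<close>

datatype torus_label = c nat | d nat

text \<open>Brackets are additive over the three families of the definition, and antisymmetric.  This
  matters only for \<open>n = 1\<close>, where both \<open>{c\<^sub>0, c\<^sub>1}\<close> and \<open>{c\<^sub>1, c\<^sub>0}\<close> occur in the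
  family \<open>{c\<^sub>k, c\<^sub>k\<^sub>+\<^sub>1}\<close>, and the two contributions cancel.\<close>

fun torus_omega :: "nat \<Rightarrow> torus_label \<Rightarrow> torus_label \<Rightarrow> complex" where
  "torus_omega n (c i) (d j) = 2 * of_bool (j = i) - 2 * of_bool (j = (i + 1) mod (n + 1))"
| "torus_omega n (d j) (c i) = 2 * of_bool (j = (i + 1) mod (n + 1)) - 2 * of_bool (j = i)"
| "torus_omega n (c i) (c j) =
     2 * of_bool (i = (j + 1) mod (n + 1)) - 2 * of_bool (j = (i + 1) mod (n + 1))"
| "torus_omega n (d i) (d j) = 0"

definition poisson_torus :: "nat \<Rightarrow> (torus_label \<Rightarrow> complex) poisson_space" where
  "poisson_torus n = log_canonical_torus (c ` {0..n} \<union> d ` {0..n}) (torus_omega n)"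

definition H1 :: "nat \<Rightarrow> (torus_label \<Rightarrow> complex) \<Rightarrow> complex" where
  "H1 n x = (\<Sum>i=0..n. x (c i) + x (d i))"

definition torus_point :: "nat \<Rightarrow> (nat \<Rightarrow> complex) \<Rightarrow> (nat \<Rightarrow> complex) \<Rightarrow> torus_label \<Rightarrow> complex" where
  "torus_point n u v =
     (\<lambda>l \<in> c ` {0..n} \<union> d ` {0..n}. case l of c i \<Rightarrow> u i | d i \<Rightarrow> v i)"


section \<open>The relativistic periodic Toda system\<close>

datatype toda_label = p nat | q nat

fun toda_pi :: "toda_label \<Rightarrow> toda_label \<Rightarrow> complex" where
  "toda_pi (p j) (q k) = of_bool (j = k)"
| "toda_pi (q k) (p j) = - of_bool (j = k)"
| "toda_pi (p j) (p k) = 0"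
| "toda_pi (q j) (q k) = 0"

text \<open>The functions are the holomorphic ones (continuous and separately holomorphic).\<close>

definition toda_space :: "nat \<Rightarrow> (toda_label \<Rightarrow> complex) poisson_space" where
  "toda_space n =
    (let I = p ` {0..n} \<union> q ` {0..n} in
     \<lparr>points = I \<rightarrow>\<^sub>E UNIV,
      funs = {f. continuous_on (I \<rightarrow>\<^sub>E UNIV) f \<and>
                 (\<forall>x \<in> I \<rightarrow>\<^sub>E UNIV. \<forall>a\<in>I. (\<lambda>t. f (x(a := t))) holomorphic_on UNIV)},
      bracket = coord_bracket I (\<lambda>a b x. toda_pi a b)\<rparr>)"

definition toda_hamiltonian :: "nat \<Rightarrow> complex \<Rightarrow> (toda_label \<Rightarrow> complex) \<Rightarrow> complex" where
  "toda_hamiltonian n h x =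
     (\<Sum>k=0..n. exp (h * x (p k)) * (1 + h\<^sup>2 * exp (x (q ((k + 1) mod (n + 1))) - x (q k))))"

definition toda_map :: "nat \<Rightarrow> (toda_label \<Rightarrow> complex) \<Rightarrow> torus_label \<Rightarrow> complex" where
  "toda_map n x = torus_point n
     (\<lambda>i. 4 * exp (2 * x (p i) - x (q i) + x (q ((i + 1) mod (n + 1)))))
     (\<lambda>i. exp (2 * x (p i)))"


section \<open>The central extension of the loop group\<close>

definition SL :: "nat \<Rightarrow> 'a::comm_ring_1 mat monoid" where
  "SL m = \<lparr>carrier = {M \<in> carrier_mat m m. Determinant.det M = 1}, mult = (*), one = 1\<^sub>m m\<rparr>"

text \<open>The ring of Laurent polynomials \<open>\<complex>[z\<^sup>\<plusminus>\<^sup>1]\<close> is the group algebra of the integers, with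
  \<open>Poly_Mapping.single k r\<close> standing for \<open>r z\<^sup>k\<close>.\<close>

type_synonym laurent = "int \<Rightarrow>\<^sub>0 complex"

text \<open>The standard root subgroups of the loop group.  With matrix indices \<open>0, \<dots>, n\<close>, the simple
  root \<open>\<alpha>\<^sub>i\<close> for \<open>i \<ge> 1\<close> lives in the rows and columns \<open>i - 1, i\<close>; for the affine root the raising
  operator is \<open>z\<close> times the matrix unit in row \<open>n\<close> and column \<open>0\<close>.\<close>

definition loop_root_SL2 :: "nat \<Rightarrow> nat \<Rightarrow> complex mat \<Rightarrow> laurent mat" where
  "loop_root_SL2 n i M =
    (let k = (i + n) mod (n + 1); e = (if i = 0 then 1 else 0) in
     Matrix.mat (n + 1) (n + 1) (\<lambda>(r, s).
       if (r, s) = (k, k) then Poly_Mapping.single 0 (M $$ (0, 0))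
       else if (r, s) = (k, i) then Poly_Mapping.single e (M $$ (0, 1))
       else if (r, s) = (i, k) then Poly_Mapping.single (- e) (M $$ (1, 0))
       else if (r, s) = (i, i) then Poly_Mapping.single 0 (M $$ (1, 1))
       else if r = s then 1 else 0))"

definition mat2 :: "complex \<Rightarrow> complex \<Rightarrow> complex \<Rightarrow> complex \<Rightarrow> complex mat" where
  "mat2 a b a' b' = mat_of_rows_list 2 [[a, b], [a', b']]"

text \<open>The ordered product \<open>f 0 \<otimes> f 1 \<otimes> \<dots> \<otimes> f n\<close>.\<close>

definition ordered_prod :: "('g, 'm) monoid_scheme \<Rightarrow> nat \<Rightarrow> (nat \<Rightarrow> 'g) \<Rightarrow> 'g" where
  "ordered_prod G n f = foldr (\<lambda>i y. f i \<otimes>\<^bsub>G\<^esub> y) [0..<n + 1] \<one>\<^bsub>G\<^esub>"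

definition Cstar :: "complex monoid" where
  "Cstar = \<lparr>carrier = - {0}, mult = (*), one = 1\<rparr>"

text \<open>The group \<open>G\<close>, with projection \<open>pr\<close> to the loop group and with homomorphisms
  \<open>\<phi>\<^sub>0, \<dots>, \<phi>\<^sub>n\<close> lifting the standard root subgroups, is the universal central extension by
  \<open>\<complex>\<^sup>*\<close>.  The last assumption identifies the central \<open>\<complex>\<^sup>*\<close> with the one-parameter subgroup of
  the canonical central element \<open>\<alpha>\<^sub>0\<^sup>\<or> + \<dots> + \<alpha>\<^sub>n\<^sup>\<or>\<close> of the affine Kac-Moody algebra; this separates
  the universal extension (level one) from the other central extensions by \<open>\<complex>\<^sup>*\<close>, such as the
  trivial one, for which this subgroup does not map isomorphically to the kernel.\<close>

locale central_loop_extension = group G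
  for n :: nat and G :: "('g, 'm) monoid_scheme" (structure)
    and pr :: "'g \<Rightarrow> laurent mat" and \<phi> :: "nat \<Rightarrow> complex mat \<Rightarrow> 'g" +
  assumes pr_hom: "pr \<in> hom G (SL (n + 1))"
    and pr_surj: "pr ` carrier G = carrier (SL (n + 1))"
    and central: "x \<in> kernel G (SL (n + 1)) pr \<Longrightarrow> y \<in> carrier G \<Longrightarrow> x \<otimes> y = y \<otimes> x"
    and root_hom: "i \<le> n \<Longrightarrow> \<phi> i \<in> hom (SL 2) G"
    and root_lift: "i \<le> n \<Longrightarrow> M \<in> carrier (SL 2) \<Longrightarrow> pr (\<phi> i M) = loop_root_SL2 n i M"
    and central_iso:
      "(\<lambda>t. ordered_prod G n (\<lambda>i. \<phi> i (mat2 t 0 0 (inverse t))))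
         \<in> iso Cstar (G\<lparr>carrier := kernel G (SL (n + 1)) pr\<rparr>)"


section \<open>The Coxeter-Toda system\<close>

definition cartan :: "nat \<Rightarrow> nat \<Rightarrow> nat \<Rightarrow> int" where
  "cartan n i j = (if i = j then 2
     else - of_bool (j = (i + 1) mod (n + 1)) - of_bool (i = (j + 1) mod (n + 1)))"

datatype cell_label = A nat | B nat | C nat | D nat

fun cell_omega :: "cell_label \<Rightarrow> cell_label \<Rightarrow> complex" where
  "cell_omega (B i) (A j) = of_bool (i = j)"
| "cell_omega (A j) (B i) = - of_bool (i = j)"
| "cell_omega (D i) (C j) = of_bool (i = j)"
| "cell_omega (C j) (D i) = - of_bool (i = j)"
| "cell_omega _ _ = 0"

definition cell_coords :: "nat \<Rightarrow> (cell_label \<Rightarrow> complex) poisson_space" where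
  "cell_coords n =
     log_canonical_torus (A ` {0..n} \<union> B ` {0..n} \<union> C ` {0..n} \<union> D ` {0..n}) cell_omega"

definition factorization ::
  "nat \<Rightarrow> ('g, 'm) monoid_scheme \<Rightarrow> (nat \<Rightarrow> complex mat \<Rightarrow> 'g) \<Rightarrow> (cell_label \<Rightarrow> complex) \<Rightarrow> 'g" where
  "factorization n G \<phi> y =
     ordered_prod G n (\<lambda>i. \<phi> i (mat2 (y (A i)) (y (B i)) 0 (inverse (y (A i)))))
     \<otimes>\<^bsub>G\<^esub> ordered_prod G n (\<lambda>i. \<phi> i (mat2 (inverse (y (D i))) 0 (y (C i)) (y (D i))))"

text \<open>The Poisson structure is the one for which the factorization map is Poisson: the value at \<open>x\<close>
  of the bracket of two functions is the common value, at all factorizations of \<open>x\<close>, of the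
  bracket of their pullbacks.\<close>

definition coxeter_toda_space ::
  "nat \<Rightarrow> ('g, 'm) monoid_scheme \<Rightarrow> (nat \<Rightarrow> complex mat \<Rightarrow> 'g) \<Rightarrow> 'g poisson_space" where
  "coxeter_toda_space n G \<phi> =
    (let Y = cell_coords n; \<Phi> = factorization n G \<phi> in
     \<lparr>points = \<Phi> ` points Y,
      funs = {f. f \<circ> \<Phi> \<in> funs Y},
      bracket = (\<lambda>f g x. THE w. \<forall>y\<in>points Y. \<Phi> y = x \<longrightarrow> bracket Y (f \<circ> \<Phi>) (g \<circ> \<Phi>) y = w)\<rparr>)"

text \<open>A factorization \<open>(A\<^sub>i, B\<^sub>i, C\<^sub>i, D\<^sub>i)\<close> of an element is not unique, but the functions
  \<open>T\<^sub>i, V\<^sub>i, W\<^sub>i, S\<^sub>i\<close> do not depend on the choice.\<close>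

definition factors ::
  "nat \<Rightarrow> ('g, 'm) monoid_scheme \<Rightarrow> (nat \<Rightarrow> complex mat \<Rightarrow> 'g) \<Rightarrow> 'g \<Rightarrow> cell_label \<Rightarrow> complex" where
  "factors n G \<phi> = inv_into (points (cell_coords n)) (factorization n G \<phi>)"

context
  fixes n :: nat and G :: "('g, 'm) monoid_scheme" and \<phi> :: "nat \<Rightarrow> complex mat \<Rightarrow> 'g"
begin

definition T :: "nat \<Rightarrow> 'g \<Rightarrow> complex" where
  "T i x = (let y = factors n G \<phi> x in y (A i) * inverse (y (D i)))"

definition V :: "nat \<Rightarrow> 'g \<Rightarrow> complex" where
  "V i x = (let y = factors n G \<phi> x in
     y (B i) * y (D i) * (\<Prod>k\<in>{0..<i}. y (D k) powi cartan n k i))"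

definition W :: "nat \<Rightarrow> 'g \<Rightarrow> complex" where
  "W i x = (let y = factors n G \<phi> x in
     (\<Prod>k\<in>{i<..n}. y (A k) powi (- cartan n k i)) * inverse (y (A i)) * y (C i))"

definition S :: "nat \<Rightarrow> 'g \<Rightarrow> complex" where
  "S i x = V i x * W i x"

text \<open>The index \<open>i - 1\<close> modulo \<open>n + 1\<close> is \<open>(i + n) mod (n + 1)\<close>.\<close>

definition coxeter_toda_map :: "'g \<Rightarrow> torus_label \<Rightarrow> complex" where
  "coxeter_toda_map x = torus_point n
     (\<lambda>i. S i x * T i x * inverse (T ((i + n) mod (n + 1)) x))
     (\<lambda>i. T i x * inverse (T ((i + n) mod (n + 1)) x))"

end

definition evaluation_character :: "('g \<Rightarrow> laurent mat) \<Rightarrow> 'g \<Rightarrow> laurent" where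
  "evaluation_character pr x = (\<Sum>i = 0..<dim_row (pr x). pr x $$ (i, i))"

definition coxeter_toda_hamiltonian :: "('g \<Rightarrow> laurent mat) \<Rightarrow> 'g \<Rightarrow> complex" where
  "coxeter_toda_hamiltonian pr x = Poly_Mapping.lookup (evaluation_character pr x) 0"

end

theory Submission
  imports Defs
begin

text \<open>
  Both maps are monomial in suitable coordinates: the components of the Toda map are exponentials
  of linear functions of \<open>p, q\<close>, and those of the Coxeter-Toda map are Laurent monomials in
  the factorization coordinates \<open>A\<^sub>i, B\<^sub>i, C\<^sub>i, D\<^sub>i\<close>.  The logarithmic partial derivatives of such
  functions are constants, up to a factor \<open>1 / x\<^sub>a\<close> in the torus case, so by the chain rule
  (\<open>coord_bracket_pullback\<close>) the Poisson property becomes a finite identity between two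
  skew-symmetric matrices and the matrix of exponents (\<open>toda_map_bracket\<close>, \<open>cell_exponent_bracket\<close>).
  For the Toda system, \<open>H\<^sub>1\<close> pulls back to the Hamiltonian by inspection.

  For the Coxeter-Toda system it has to be shown that the monomials \<open>c\<^sub>i\<close> and \<open>d\<^sub>i\<close> in the factorization
  coordinates descend to functions on the group, and that the constant term of the trace is the
  sum of all \<open>c\<^sub>i + d\<^sub>i\<close>.  Both follow from the principal grading.  A Laurent matrix of size
  \<open>n + 1\<close> is the same as a banded matrix indexed by pairs of integers and invariant under the
  diagonal shift by \<open>n + 1\<close> (\<open>unroll\<close>), with multiplication of matrices (\<open>unroll_mult\<close>).  In
  this picture all simple roots, the affine one included, look alike: the \<open>i\<close>-th upper factor
  consists of the diagonal and of entries just above it, in the columns congruent to \<open>i\<close>.  Write the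
  image of a group element in the loop group as \<open>P Q\<close>, with \<open>P\<close> the product of the upper factors
  and \<open>Q\<close> that of the lower ones.  Reading off entries
  gives, for \<open>a \<equiv> i - 1\<close> modulo \<open>n + 1\<close>,
  \<open>d\<^sub>i = P(a, a) Q(a, a)\<close> and \<open>c\<^sub>i = P(a, a + 1) Q(a + 1, a)\<close>
  (\<open>cell_d_unroll\<close>, \<open>cell_c_unroll\<close>).

  If \<open>P Q = P' Q'\<close>, then \<open>P'\<^sup>-\<^sup>1 P = Q' Q\<^sup>-\<^sup>1\<close> is both upper and lower triangular, hence diagonal, and a
  diagonal matrix moved from \<open>Q'\<close> to \<open>P'\<close> cancels in both products (\<open>cell_map_fibre\<close>).  In the constant
  term of the trace, \<open>\<Sum>\<^sub>a \<Sum>\<^sub>k P(a, k) Q(k, a)\<close>, only \<open>k = a\<close> and \<open>k = a + 1\<close> survive: an entry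
  \<open>P(a, k)\<close> with \<open>k \<ge> a + 2\<close> uses the factors numbered \<open>a + 1\<close> and \<open>a + 2\<close> (modulo \<open>n + 1\<close>) in this
  order, the entry \<open>Q(k, a)\<close> uses them in the opposite order, and both products run through the
  factors in increasing order (\<open>ladder_two_steps\<close>, \<open>unroll_raising_lowering_diag\<close>).

  The images are computed by solving for preimages: \<open>\<Prod>\<^sub>i d\<^sub>i = 1\<close> lets the ratios \<open>T\<^sub>i / T\<^sub>i\<^sub>-\<^sub>1\<close> be
  integrated around the cycle, and \<open>\<Prod>\<^sub>i c\<^sub>i = 4\<^sup>n\<^sup>+\<^sup>1 \<Prod>\<^sub>i d\<^sub>i\<close> does the same for the
  ratios \<open>exp (q\<^sub>i\<^sub>+\<^sub>1 - q\<^sub>i)\<close>.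
\<close>

section \<open>Laurent polynomials and coordinate brackets\<close>

lemma laurent_polys_differentiable:
  assumes "f \<in> laurent_polys I" "\<And>b. b \<in> I \<Longrightarrow> x b \<noteq> 0" "a \<in> I"
  shows "((\<lambda>t. f (x(a := t))) has_field_derivative pd a f x) (at (x a))"
proof -
  have "(\<lambda>t. f (x(a := t))) field_differentiable (at (x a))"
    using assms
  proof induction
    case (const r) show ?case by simp
  next
    case (coord b) show ?case by (cases "a = b") simp_all
  next
    case (coord_inv b) then show ?case
      by (cases "a = b") (auto intro!: derivative_intros)
  next
    case (add f g) then show ?case by (auto intro!: derivative_intros)
  next
    case (mult f g) then show ?case by (auto intro!: derivative_intros)
  qed
  then show ?thesis unfolding pd_def by (rule field_differentiable_derivI)
qed

lemma pd_add:
  assumes "f \<in> laurent_polys I" "g \<in> laurent_polys I" "\<And>b. b \<in> I \<Longrightarrow> x b \<noteq> 0" "a \<in> I"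
  shows "pd a (\<lambda>x. f x + g x) x = pd a f x + pd a g x"
proof -
  have D: "((\<lambda>t. h (x(a := t))) has_field_derivative pd a h x) (at (x a))"
    if "h \<in> laurent_polys I" for h
    using laurent_polys_differentiable[OF that, of x a] assms(3,4) by blast
  show ?thesis
    unfolding pd_def[of a "\<lambda>x. f x + g x"]
    using DERIV_add[OF D[OF assms(1)] D[OF assms(2)]] by (intro DERIV_imp_deriv) auto
qed

lemma pd_mult:
  assumes "f \<in> laurent_polys I" "g \<in> laurent_polys I" "\<And>b. b \<in> I \<Longrightarrow> x b \<noteq> 0" "a \<in> I"
  shows "pd a (\<lambda>x. f x * g x) x = pd a f x * g x + f x * pd a g x"
proof -
  have D: "((\<lambda>t. h (x(a := t))) has_field_derivative pd a h x) (at (x a))"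
    if "h \<in> laurent_polys I" for h
    using laurent_polys_differentiable[OF that, of x a] assms(3,4) by blast
  show ?thesis
    unfolding pd_def[of a "\<lambda>x. f x * g x"]
    using DERIV_mult[OF D[OF assms(1)] D[OF assms(2)]]
    by (intro DERIV_imp_deriv) (auto simp: algebra_simps)
qed

lemma pd_const: "pd a (\<lambda>x. r) x = 0"
  by (simp add: pd_def)

lemma pd_coord: "pd a (\<lambda>x. x b) x = of_bool (a = b)"
  by (cases "a = b") (simp_all add: pd_def)

lemma pd_coord_inv:
  assumes "x b \<noteq> 0"
  shows "pd a (\<lambda>x. inverse (x b)) x = - of_bool (a = b) / (x b)\<^sup>2"
proof (cases "a = b")
  case True
  have "((\<lambda>t. inverse t) has_field_derivative - (inverse (x b) ^ Suc (Suc 0))) (at (x b))"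
    by (rule DERIV_inverse) fact
  then show ?thesis using True assms
    by (simp add: pd_def DERIV_imp_deriv field_simps power2_eq_square)
qed (simp add: pd_def)

text \<open>Both sides are compatible with sums and products, by \<open>pd_add\<close> and \<open>pd_mult\<close>, so the chain rule
  along a curve follows by induction over the construction of the Laurent polynomial.\<close>

lemma laurent_polys_chain_rule:
  assumes f: "f \<in> laurent_polys I" and I: "finite I"
    and \<gamma>: "\<And>l. l \<in> I \<Longrightarrow> ((\<lambda>t. \<gamma> t l) has_field_derivative \<gamma>' l) (at s)"
    and nz: "\<And>l. l \<in> I \<Longrightarrow> \<gamma> s l \<noteq> 0"
  shows "((\<lambda>t. f (\<gamma> t)) has_field_derivative (\<Sum>l\<in>I. pd l f (\<gamma> s) * \<gamma>' l)) (at s)"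
  using f
proof induction
  case (const r) show ?case by (simp add: pd_const)
next
  case (coord a)
  have "(\<Sum>l\<in>I. pd l (\<lambda>x. x a) (\<gamma> s) * \<gamma>' l) = \<gamma>' a"
    using coord I by (simp add: pd_coord)
  then show ?case using \<gamma>[OF coord] by simp
next
  case (coord_inv a)
  have "(\<Sum>l\<in>I. pd l (\<lambda>x. inverse (x a)) (\<gamma> s) * \<gamma>' l)
      = (\<Sum>l\<in>I. if l = a then - \<gamma>' l / (\<gamma> s a)\<^sup>2 else 0)"
    by (rule sum.cong) (simp_all add: pd_coord_inv nz[OF coord_inv])
  also have "\<dots> = - \<gamma>' a / (\<gamma> s a)\<^sup>2" using coord_inv I by simp
  finally have "(\<Sum>l\<in>I. pd l (\<lambda>x. inverse (x a)) (\<gamma> s) * \<gamma>' l)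
      = - (\<gamma>' a * inverse (\<gamma> s a ^ Suc (Suc 0)))"
    by (simp add: divide_inverse power2_eq_square)
  then show ?case using DERIV_inverse_fun[OF \<gamma>[OF coord_inv] nz[OF coord_inv]] by simp
next
  case (add f g)
  show ?case
    using DERIV_add[OF add.IH] add.hyps nz
    by (simp add: pd_add sum.distrib distrib_right cong: sum.cong)
next
  case (mult f g)
  have "(\<Sum>l\<in>I. pd l (\<lambda>x. f x * g x) (\<gamma> s) * \<gamma>' l)
      = (\<Sum>l\<in>I. pd l f (\<gamma> s) * \<gamma>' l) * g (\<gamma> s) + (\<Sum>l\<in>I. pd l g (\<gamma> s) * \<gamma>' l) * f (\<gamma> s)"
    unfolding sum_distrib_right sum.distrib[symmetric]
    by (rule sum.cong) (simp_all add: pd_mult[OF mult.hyps nz] algebra_simps)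
  then show ?case
    using DERIV_mult[OF mult.IH] by simp
qed

text \<open>By the chain rule the bracket of two pullbacks is bilinear in the partial derivatives of \<open>f\<close> and
  \<open>g\<close>, with coefficients the brackets of the components of \<open>F\<close>.  It therefore suffices to check the
  Poisson property on coordinate functions.\<close>

lemma coord_bracket_pullback:
  assumes I: "finite I" and f: "f \<in> laurent_polys I" and g: "g \<in> laurent_polys I"
    and nz: "\<And>l. l \<in> I \<Longrightarrow> F x l \<noteq> 0"
    and F': "\<And>l a. l \<in> I \<Longrightarrow> a \<in> J \<Longrightarrow>
      ((\<lambda>t. F (x(a := t)) l) has_field_derivative F' l a) (at (x a))"
    and br: "\<And>l l'. l \<in> I \<Longrightarrow> l' \<in> I \<Longrightarrow>
      (\<Sum>a\<in>J. \<Sum>b\<in>J. \<pi> a b x * F' l a * F' l' b) = \<rho> l l' (F x)"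
  shows "coord_bracket J \<pi> (f \<circ> F) (g \<circ> F) x = coord_bracket I \<rho> f g (F x)"
proof -
  have pd: "pd a (h \<circ> F) x = (\<Sum>l\<in>I. pd l h (F x) * F' l a)"
    if "h \<in> laurent_polys I" "a \<in> J" for h a
    using laurent_polys_chain_rule[OF that(1) I, of "\<lambda>t. F (x(a := t))" "\<lambda>l. F' l a" "x a"] F' nz that(2)
    by (auto simp: pd_def o_def intro!: DERIV_imp_deriv)
  have "coord_bracket J \<pi> (f \<circ> F) (g \<circ> F) x
      = (\<Sum>a\<in>J. \<Sum>b\<in>J. \<Sum>l\<in>I. \<Sum>l'\<in>I.
           pd l f (F x) * pd l' g (F x) * (\<pi> a b x * F' l a * F' l' b))"
    unfolding coord_bracket_def
    by (intro sum.cong refl)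
      (simp add: pd[OF f] pd[OF g] sum_product sum_distrib_left sum_distrib_right mult_ac)
  also have "\<dots> = (\<Sum>a\<in>J. \<Sum>l\<in>I. \<Sum>l'\<in>I. \<Sum>b\<in>J.
           pd l f (F x) * pd l' g (F x) * (\<pi> a b x * F' l a * F' l' b))"
    by (intro sum.cong refl) (simp only: sum.swap[where A = J])
  also have "\<dots> = (\<Sum>l\<in>I. \<Sum>l'\<in>I. \<Sum>a\<in>J. \<Sum>b\<in>J.
           pd l f (F x) * pd l' g (F x) * (\<pi> a b x * F' l a * F' l' b))"
    by (subst sum.swap, intro sum.cong refl, rule sum.swap)
  also have "\<dots> = coord_bracket I \<rho> f g (F x)"
    unfolding coord_bracket_def
    by (intro sum.cong refl) (simp add: br[symmetric] sum_distrib_left mult_ac)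
  finally show ?thesis .
qed

text \<open>A function on a space of coordinates matters only through its values on points, because the sets
  of points are open in each coordinate direction.\<close>

lemma pd_local_cong:
  assumes "\<And>y. y \<in> I \<rightarrow>\<^sub>E U \<Longrightarrow> f y = g y" "open U" "x \<in> I \<rightarrow>\<^sub>E U" "a \<in> I"
  shows "pd a f x = pd a g x"
  unfolding pd_def
proof (rule deriv_cong_ev)
  have "x a \<in> U" using assms(3,4) by auto
  then have "\<forall>\<^sub>F t in nhds (x a). t \<in> U" using assms(2) by (rule eventually_nhds_in_open[rotated])
  then show "\<forall>\<^sub>F t in nhds (x a). f (x(a := t)) = g (x(a := t))"
  proof eventually_elim
    case (elim t)
    then have "x(a := t) \<in> I \<rightarrow>\<^sub>E U" using assms(3,4) by (auto simp: PiE_def extensional_def)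
    then show ?case by (rule assms(1))
  qed
qed simp

lemma coord_bracket_local_cong:
  assumes "\<And>y. y \<in> I \<rightarrow>\<^sub>E U \<Longrightarrow> f y = f' y" "\<And>y. y \<in> I \<rightarrow>\<^sub>E U \<Longrightarrow> g y = g' y"
    "open U" "x \<in> I \<rightarrow>\<^sub>E U"
  shows "coord_bracket I \<pi> f g x = coord_bracket I \<pi> f' g' x"
  unfolding coord_bracket_def
  by (intro sum.cong refl arg_cong2[where f = "(*)"] pd_local_cong[OF assms(1,3,4)] pd_local_cong[OF assms(2,3,4)])

lemma laurent_polys_compose:
  assumes "f \<in> laurent_polys I" "\<And>l. l \<in> I \<Longrightarrow> (\<lambda>x. F x l) \<in> laurent_polys J"
    "\<And>l. l \<in> I \<Longrightarrow> (\<lambda>x. inverse (F x l)) \<in> laurent_polys J"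
  shows "(\<lambda>x. f (F x)) \<in> laurent_polys J"
  using assms(1) by induction (auto intro: laurent_polys.intros assms(2,3))

lemma laurent_polys_sum:
  "finite K \<Longrightarrow> (\<And>k. k \<in> K \<Longrightarrow> f k \<in> laurent_polys I) \<Longrightarrow> (\<lambda>x. \<Sum>k\<in>K. f k x) \<in> laurent_polys I"
  by (induction K rule: finite_induct) (auto intro: laurent_polys.intros)

lemma laurent_polys_prod:
  "finite K \<Longrightarrow> (\<And>k. k \<in> K \<Longrightarrow> f k \<in> laurent_polys I) \<Longrightarrow> (\<lambda>x. \<Prod>k\<in>K. f k x) \<in> laurent_polys I"
  by (induction K rule: finite_induct) (auto intro: laurent_polys.intros)

lemma open_nonzero: "open (- {0 :: complex})"
  by (simp add: open_Compl)

section \<open>The Poisson torus and its Casimir functions\<close>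

abbreviation torus_labels :: "nat \<Rightarrow> torus_label set" where
  "torus_labels n \<equiv> c ` {0..n} \<union> d ` {0..n}"

lemma points_poisson_torus: "points (poisson_torus n) = torus_labels n \<rightarrow>\<^sub>E (- {0})"
  and funs_poisson_torus: "funs (poisson_torus n) =
    {f. \<exists>g\<in>laurent_polys (torus_labels n). \<forall>x\<in>points (poisson_torus n). f x = g x}"
  and bracket_poisson_torus: "bracket (poisson_torus n) =
    coord_bracket (torus_labels n) (\<lambda>a b x. torus_omega n a b * x a * x b)"
  by (simp_all add: poisson_torus_def log_canonical_torus_def)

lemma laurent_polys_in_funs:
  "f \<in> laurent_polys (torus_labels n) \<Longrightarrow> f \<in> funs (poisson_torus n)"
  by (auto simp: funs_poisson_torus)

lemma H1_in_funs: "H1 n \<in> funs (poisson_torus n)"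
  unfolding H1_def[abs_def]
  by (intro laurent_polys_in_funs laurent_polys_sum laurent_polys.add laurent_polys.coord) auto

lemma torus_point_simps:
  "i \<le> n \<Longrightarrow> torus_point n u v (c i) = u i" "i \<le> n \<Longrightarrow> torus_point n u v (d i) = v i"
  by (auto simp: torus_point_def)

lemma torus_point_in_points:
  "torus_point n u v \<in> points (poisson_torus n) \<longleftrightarrow> (\<forall>i\<le>n. u i \<noteq> 0 \<and> v i \<noteq> 0)"
  by (auto simp: points_poisson_torus torus_point_def PiE_iff ball_Un)

lemma eq_torus_pointI:
  assumes "x \<in> points (poisson_torus n)"
    "\<And>i. i \<le> n \<Longrightarrow> x (c i) = u i" "\<And>i. i \<le> n \<Longrightarrow> x (d i) = v i"
  shows "x = torus_point n u v"
  using assms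
  by (auto simp: points_poisson_torus torus_point_def PiE_iff extensional_def fun_eq_iff)

lemma H1_torus_point: "H1 n (torus_point n u v) = (\<Sum>i=0..n. u i + v i)"
  by (simp add: H1_def torus_point_simps)

lemma mod_succ: "(i::nat) \<le> n \<Longrightarrow> (i + 1) mod (n + 1) = (if i = n then 0 else i + 1)"
  by simp

lemma mod_pred: "(i::nat) \<le> n \<Longrightarrow> (i + n) mod (n + 1) = (if i = 0 then n else i - 1)"
proof (cases "i = 0")
  case False
  assume "i \<le> n"
  then have "i + n = (i - 1) + (n + 1)" "i - 1 < n + 1" using False by simp_all
  then show ?thesis using False by (metis mod_add_self2 mod_less)
qed simp

text \<open>The cyclic predecessor is written as \<open>(j + n) mod (n + 1)\<close>; it is inverse to the cyclic successor.\<close>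

lemma mod_succ_eq_iff:
  assumes "(i::nat) \<le> n" "j \<le> n"
  shows "j = (i + 1) mod (n + 1) \<longleftrightarrow> i = (j + n) mod (n + 1)"
proof -
  have "j = (if i = n then 0 else i + 1) \<longleftrightarrow> i = (if j = 0 then n else j - 1)"
    using assms by (cases "i = n"; cases "j = 0") auto
  then show ?thesis by (simp only: mod_succ[OF assms(1)] mod_pred[OF assms(2)])
qed

lemma mod_le: "(i::nat) mod (n + 1) \<le> n"
  using mod_less_divisor[of "n + 1" i] by linarith

lemma bij_betw_mod_succ: "bij_betw (\<lambda>i::nat. (i + 1) mod (n + 1)) {0..n} {0..n}"
  and bij_betw_mod_pred: "bij_betw (\<lambda>i::nat. (i + n) mod (n + 1)) {0..n} {0..n}"
proof -
  have 1: "((i + 1) mod (n + 1) + n) mod (n + 1) = i" if "i \<le> n" for i :: nat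
    using iffD1[OF mod_succ_eq_iff[OF that mod_le[of "i + 1"]] refl] by (rule sym)
  have 2: "((i + n) mod (n + 1) + 1) mod (n + 1) = i" if "i \<le> n" for i :: nat
    using iffD2[OF mod_succ_eq_iff[OF mod_le[of "i + n"] that] refl] by (rule sym)
  show "bij_betw (\<lambda>i::nat. (i + 1) mod (n + 1)) {0..n} {0..n}"
    by (rule bij_betw_byWitness[where f' = "\<lambda>j. (j + n) mod (n + 1)"])
      (auto simp only: 1 2 mod_le atLeastAtMost_iff le0)
  show "bij_betw (\<lambda>i::nat. (i + n) mod (n + 1)) {0..n} {0..n}"
    by (rule bij_betw_byWitness[where f' = "\<lambda>j. (j + 1) mod (n + 1)"])
      (auto simp only: 1 2 mod_le atLeastAtMost_iff le0)
qed

text \<open>The logarithmic derivatives of \<open>\<Prod>a\<in>K. x a\<close> are the indicator function of \<open>K\<close>, so its bracket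
  with \<open>x\<^sub>b\<close> is a multiple of the column sum \<open>\<Sum>a\<in>K. \<omega> a b\<close>.\<close>

lemma casimir_log_canonical_torus:
  assumes "finite I" "K \<subseteq> I" and \<omega>: "\<And>b. b \<in> I \<Longrightarrow> (\<Sum>a\<in>K. \<omega> a b) = 0"
  shows "casimir (log_canonical_torus I \<omega>) (\<lambda>x. \<Prod>a\<in>K. x a)"
proof -
  have K: "finite K" using assms finite_subset by auto
  have LP: "(\<lambda>x. \<Prod>a\<in>K. x a) \<in> laurent_polys I"
    using assms K by (intro laurent_polys_prod laurent_polys.coord) auto
  have "coord_bracket I (\<lambda>a b x. \<omega> a b * x a * x b) (\<lambda>x. \<Prod>a\<in>K. x a) f x = 0"
    if x: "x \<in> I \<rightarrow>\<^sub>E (- {0})" for f x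
  proof -
    have pd: "x a * pd a (\<lambda>x. \<Prod>a\<in>K. x a) x = of_bool (a \<in> K) * (\<Prod>a\<in>K. x a)" if "a \<in> I" for a
    proof (cases "a \<in> K")
      case True
      have "(\<lambda>t. \<Prod>b\<in>K. (x(a := t)) b) = (\<lambda>t. t * (\<Prod>b\<in>K - {a}. x b))"
        by (rule ext, subst prod.remove[OF K True]) (auto intro!: prod.cong)
      then have "pd a (\<lambda>x. \<Prod>a\<in>K. x a) x = (\<Prod>b\<in>K - {a}. x b)"
        by (simp add: pd_def)
      then show ?thesis using True by (simp add: prod.remove[OF K True])
    next
      case False
      then have "(\<lambda>t. \<Prod>b\<in>K. (x(a := t)) b) = (\<lambda>t. \<Prod>b\<in>K. x b)"
        by (intro ext prod.cong) auto
      then show ?thesis using False by (simp add: pd_def)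
    qed
    have "coord_bracket I (\<lambda>a b x. \<omega> a b * x a * x b) (\<lambda>x. \<Prod>a\<in>K. x a) f x
        = (\<Sum>a\<in>I. \<Sum>b\<in>I. \<omega> a b * (x a * pd a (\<lambda>x. \<Prod>a\<in>K. x a) x) * (x b * pd b f x))"
      by (simp add: coord_bracket_def mult_ac)
    also have "\<dots> = (\<Sum>a\<in>I. \<Sum>b\<in>I. if a \<in> K then \<omega> a b * ((\<Prod>a\<in>K. x a) * (x b * pd b f x)) else 0)"
      by (intro sum.cong refl) (simp add: pd)
    also have "\<dots> = (\<Sum>b\<in>I. \<Sum>a\<in>I. if a \<in> K then \<omega> a b * ((\<Prod>a\<in>K. x a) * (x b * pd b f x)) else 0)"
      by (rule sum.swap)
    also have "\<dots> = (\<Sum>b\<in>I. (\<Sum>a\<in>K. \<omega> a b) * ((\<Prod>a\<in>K. x a) * (x b * pd b f x)))"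
      using assms by (simp add: sum.If_cases Int_absorb1 flip: sum_distrib_right)
    also have "\<dots> = 0" by (rule sum.neutral) (simp add: \<omega>)
    finally show ?thesis .
  qed
  with LP show ?thesis by (auto simp: casimir_def log_canonical_torus_def)
qed

lemma sum_of_bool_eq:
  fixes f :: "nat \<Rightarrow> complex"
  shows "i \<le> n \<Longrightarrow> (\<Sum>k=0..n. of_bool (k = i) * f k) = f i"
  by (simp add: of_bool_def if_distrib[of "\<lambda>x. x * _"] cong: if_cong)

lemma sum_torus_omega:
  assumes "b \<in> torus_labels n"
  shows "(\<Sum>i=0..n. torus_omega n (c i) b) = 0" "(\<Sum>i=0..n. torus_omega n (d i) b) = 0"
proof -
  have one: "(\<Sum>i=0..n. of_bool (i = j)) = (1::complex)" if "j \<le> n" for j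
    using that sum_of_bool_eq[of j n "\<lambda>_. 1"] by simp
  have one': "(\<Sum>i=0..n. of_bool (j = i)) = (1::complex)" if "j \<le> n" for j
    using one[OF that] by (simp only: eq_commute[where b = j])
  have two: "(\<Sum>i=0..n. of_bool (j = (i + 1) mod (n + 1))) = (1::complex)" if "j \<le> n" for j
  proof -
    have "(\<Sum>i=0..n. of_bool (j = (i + 1) mod (n + 1)))
        = (\<Sum>i=0..n. of_bool (i = (j + n) mod (n + 1)) :: complex)"
      using that by (intro sum.cong refl) (simp only: mod_succ_eq_iff atLeastAtMost_iff)
    also have "\<dots> = 1" by (rule one) (simp add: less_Suc_eq_le[symmetric])
    finally show ?thesis .
  qed
  have three: "(\<Sum>i=0..n. of_bool (i = (j + 1) mod (n + 1))) = (1::complex)" for j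
    by (rule one) (simp add: less_Suc_eq_le[symmetric])
  show "(\<Sum>i=0..n. torus_omega n (c i) b) = 0" "(\<Sum>i=0..n. torus_omega n (d i) b) = 0"
    using assms
    by (elim UnE imageE; simp only: torus_omega.simps sum_subtractf sum_distrib_left[symmetric]
        one one' two three sum.neutral_const atLeastAtMost_iff diff_self)+
qed

lemma casimir_poisson_torus:
  "casimir (poisson_torus n) (\<lambda>x. \<Prod>i=0..n. x (c i))"
  "casimir (poisson_torus n) (\<lambda>x. \<Prod>i=0..n. x (d i))"
proof -
  have "casimir (poisson_torus n) (\<lambda>x. \<Prod>l\<in>c ` {0..n}. x l)"
    unfolding poisson_torus_def
    by (rule casimir_log_canonical_torus) (simp_all add: sum.reindex inj_on_def sum_torus_omega)
  then show "casimir (poisson_torus n) (\<lambda>x. \<Prod>i=0..n. x (c i))"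
    by (simp add: prod.reindex inj_on_def)
  have "casimir (poisson_torus n) (\<lambda>x. \<Prod>l\<in>d ` {0..n}. x l)"
    unfolding poisson_torus_def
    by (rule casimir_log_canonical_torus) (simp_all add: sum.reindex inj_on_def sum_torus_omega)
  then show "casimir (poisson_torus n) (\<lambda>x. \<Prod>i=0..n. x (d i))"
    by (simp add: prod.reindex inj_on_def)
qed

section \<open>The relativistic periodic Toda system\<close>

abbreviation toda_labels :: "nat \<Rightarrow> toda_label set" where
  "toda_labels n \<equiv> p ` {0..n} \<union> q ` {0..n}"

lemma points_toda: "points (toda_space n) = toda_labels n \<rightarrow>\<^sub>E UNIV"
  and funs_toda: "funs (toda_space n) = {f. continuous_on (toda_labels n \<rightarrow>\<^sub>E UNIV) f \<and>
     (\<forall>x \<in> toda_labels n \<rightarrow>\<^sub>E UNIV. \<forall>a\<in>toda_labels n. (\<lambda>t. f (x(a := t))) holomorphic_on UNIV)}"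
  and bracket_toda: "bracket (toda_space n) = coord_bracket (toda_labels n) (\<lambda>a b x. toda_pi a b)"
  by (simp_all add: toda_space_def Let_def)

lemma toda_hamiltonian_eq: "H1 n (toda_map n x) = toda_hamiltonian n 2 x"
  by (simp add: toda_map_def H1_torus_point toda_hamiltonian_def exp_add exp_diff algebra_simps)

lemma toda_map_in_points: "toda_map n x \<in> points (poisson_torus n)"
  by (simp add: toda_map_def torus_point_in_points)

text \<open>Closure principle for pullbacks of Laurent polynomials; it yields their continuity.\<close>

lemma laurent_polys_closure:
  assumes "f \<in> laurent_polys I" "\<And>r. P (\<lambda>_. r)"
    "\<And>f g. P f \<Longrightarrow> P g \<Longrightarrow> P (\<lambda>x. f x + g x)" "\<And>f g. P f \<Longrightarrow> P g \<Longrightarrow> P (\<lambda>x. f x * g x)"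
    "\<And>a. a \<in> I \<Longrightarrow> P (\<lambda>x. F x a)" "\<And>a. a \<in> I \<Longrightarrow> P (\<lambda>x. inverse (F x a))"
  shows "P (\<lambda>x. f (F x))"
  using assms(1) by induction (auto intro: assms)

text \<open>The partial derivative of \<open>ln\<close> of a component of the Toda map; the components are exponentials of
  linear functions, so it is constant.\<close>

fun toda_log_derivative :: "nat \<Rightarrow> torus_label \<Rightarrow> toda_label \<Rightarrow> complex" where
  "toda_log_derivative n (c i) (p k) = 2 * of_bool (k = i)"
| "toda_log_derivative n (c i) (q k) = of_bool (k = (i + 1) mod (n + 1)) - of_bool (k = i)"
| "toda_log_derivative n (d i) (p k) = 2 * of_bool (k = i)"
| "toda_log_derivative n (d i) (q k) = 0"

lemma DERIV_coord: "((\<lambda>t. (x(a := t)) b) has_field_derivative of_bool (a = b)) (at s)"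
  by (cases "a = b") auto

lemma toda_map_derivative:
  assumes "l \<in> torus_labels n" "a \<in> toda_labels n"
  shows "((\<lambda>t. toda_map n (x(a := t)) l) has_field_derivative
           toda_log_derivative n l a * toda_map n x l) (at (x a))"
  using assms(1)
proof (elim UnE imageE)
  fix i assume "l = c i" "i \<in> {0..n}"
  then have *: "l = c i" "i \<le> n" by auto
  have "((\<lambda>t. 4 * exp (2 * (x(a := t)) (p i) - (x(a := t)) (q i) + (x(a := t)) (q ((i + 1) mod (n + 1)))))
      has_field_derivative 4 * (exp (2 * x (p i) - x (q i) + x (q ((i + 1) mod (n + 1))))
        * (2 * of_bool (a = p i) - of_bool (a = q i) + of_bool (a = q ((i + 1) mod (n + 1))))))
      (at (x a))"
    by (rule DERIV_cong[OF DERIV_cmult[OF DERIV_fun_exp[OF DERIV_add[OF DERIV_diff[OF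
          DERIV_cmult[OF DERIV_coord] DERIV_coord] DERIV_coord]]]]) simp
  then show ?thesis
    using * by (cases a) (simp_all add: toda_map_def torus_point_simps algebra_simps)
next
  fix i assume "l = d i" "i \<in> {0..n}"
  then have *: "l = d i" "i \<le> n" by auto
  have "((\<lambda>t. exp (2 * (x(a := t)) (p i))) has_field_derivative
      exp (2 * x (p i)) * (2 * of_bool (a = p i))) (at (x a))"
    by (rule DERIV_cong[OF DERIV_fun_exp[OF DERIV_cmult[OF DERIV_coord]]]) simp
  then show ?thesis
    using * by (cases a) (simp_all add: toda_map_def torus_point_simps algebra_simps)
qed

lemma sum_toda_pi:
  "(\<Sum>a\<in>toda_labels n. \<Sum>b\<in>toda_labels n. toda_pi a b * u a * v b)
    = (\<Sum>k=0..n. u (p k) * v (q k) - u (q k) * v (p k))"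
proof -
  have split: "(\<Sum>a\<in>toda_labels n. h a) = (\<Sum>k=0..n. h (p k)) + (\<Sum>k=0..n. h (q k))"
    for h :: "toda_label \<Rightarrow> complex"
    by (subst sum.union_disjoint) (auto simp: sum.reindex inj_on_def)
  have delta: "(\<Sum>j=0..n. of_bool (k = j) * w * h j) = w * h k" if "k \<le> n" for w k and h :: "nat \<Rightarrow> complex"
    using that by (simp add: of_bool_def if_distrib[of "\<lambda>x. x * _"] cong: if_cong)
  have delta': "(\<Sum>j=0..n. of_bool (j = k) * w * h j) = w * h k" if "k \<le> n" for w k and h :: "nat \<Rightarrow> complex"
    using that by (simp add: of_bool_def if_distrib[of "\<lambda>x. x * _"] cong: if_cong)
  show ?thesis
    unfolding split by (simp add: delta delta' sum_negf sum_subtractf)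
qed

text \<open>The bracket of the logarithms of two components of the Toda map.  The left-hand side is
  \<open>{f, g} = \<Sum>\<^sub>k (\<partial>f/\<partial>p\<^sub>k \<partial>g/\<partial>q\<^sub>k - \<partial>f/\<partial>q\<^sub>k \<partial>g/\<partial>p\<^sub>k)\<close> for linear functions \<open>f, g\<close>.\<close>

lemma toda_map_bracket:
  assumes "l \<in> torus_labels n" "l' \<in> torus_labels n"
  shows "(\<Sum>k=0..n. toda_log_derivative n l (p k) * toda_log_derivative n l' (q k)
      - toda_log_derivative n l (q k) * toda_log_derivative n l' (p k)) = torus_omega n l l'"
proof -
  have s: "(\<Sum>k=0..n. of_bool (k = i) * h k) = h i" "(\<Sum>k=0..n. h k * of_bool (k = i)) = h i"
    if "i \<le> n" for i and h :: "nat \<Rightarrow> complex"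
    using that sum_of_bool_eq[OF that] by (simp_all only: mult.commute[of "h _"])
  show ?thesis
    using assms
    by (elim UnE imageE; simp only: toda_log_derivative.simps torus_omega.simps sum_subtractf
          right_diff_distrib left_diff_distrib mult.assoc sum_distrib_left[symmetric] s
          atLeastAtMost_iff mult_zero_left mult_zero_right sum.neutral_const mult.left_commute[of _ 2])
      (simp_all add: eq_commute)
qed

lemma toda_map_is_poisson: "poisson_map (toda_space n) (poisson_torus n) (toda_map n)"
proof -
  have "f \<circ> toda_map n \<in> funs (toda_space n)" if f: "f \<in> funs (poisson_torus n)" for f
  proof -
    obtain g where g: "g \<in> laurent_polys (torus_labels n)"
      "\<And>x. x \<in> points (poisson_torus n) \<Longrightarrow> f x = g x"
      using f by (auto simp: funs_poisson_torus)
    have fg: "f \<circ> toda_map n = (\<lambda>x. g (toda_map n x))"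
      using g(2) toda_map_in_points by (auto simp: fun_eq_iff)
    have coord: "continuous_on A (\<lambda>x::toda_label \<Rightarrow> complex. x b)" for A b
      by (rule continuous_on_subset[OF continuous_on_product_coordinates]) simp
    have "continuous_on A (\<lambda>x. g (toda_map n x))" for A
    proof (rule laurent_polys_closure[OF g(1), of "continuous_on A" "toda_map n"])
      show "continuous_on A (\<lambda>x. toda_map n x l)" "continuous_on A (\<lambda>x. inverse (toda_map n x l))"
        if "l \<in> torus_labels n" for l
        using that by (auto simp: toda_map_def torus_point_simps intro!: continuous_intros coord)
    qed (intro continuous_intros; assumption)+
    moreover have "(\<lambda>t. g (toda_map n (x(a := t)))) holomorphic_on UNIV" if "a \<in> toda_labels n" for x a
    proof -
      have "((\<lambda>t. g (toda_map n (x(a := t)))) has_field_derivative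
          (\<Sum>l\<in>torus_labels n. pd l g (toda_map n (x(a := s)))
             * (toda_log_derivative n l a * toda_map n (x(a := s)) l))) (at s)" for s
        using toda_map_derivative[OF _ that, of _ "x(a := s)"] toda_map_in_points[of n "x(a := s)"]
        by (intro laurent_polys_chain_rule[OF g(1)]) (auto simp: points_poisson_torus PiE_iff)
      then show ?thesis
        unfolding holomorphic_on_def field_differentiable_def by auto
    qed
    ultimately show ?thesis unfolding fg funs_toda by auto
  qed
  moreover have "bracket (toda_space n) (f \<circ> toda_map n) (g \<circ> toda_map n) x
      = bracket (poisson_torus n) f g (toda_map n x)"
    if f: "f \<in> funs (poisson_torus n)" and g: "g \<in> funs (poisson_torus n)" for f g x
  proof -
    note P = points_poisson_torus
    obtain f' where f': "f' \<in> laurent_polys (torus_labels n)"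
      "\<And>x. x \<in> points (poisson_torus n) \<Longrightarrow> f x = f' x"
      using f by (auto simp: funs_poisson_torus)
    obtain g' where g': "g' \<in> laurent_polys (torus_labels n)"
      "\<And>x. x \<in> points (poisson_torus n) \<Longrightarrow> g x = g' x"
      using g by (auto simp: funs_poisson_torus)
    have "f \<circ> toda_map n = f' \<circ> toda_map n" "g \<circ> toda_map n = g' \<circ> toda_map n"
      using f'(2) g'(2) toda_map_in_points by (auto simp: fun_eq_iff)
    then have "bracket (toda_space n) (f \<circ> toda_map n) (g \<circ> toda_map n) x
      = coord_bracket (toda_labels n) (\<lambda>a b x. toda_pi a b) (f' \<circ> toda_map n) (g' \<circ> toda_map n) x"
      by (simp add: bracket_toda)
    also have "\<dots> = coord_bracket (torus_labels n) (\<lambda>a b x. torus_omega n a b * x a * x b) f' g' (toda_map n x)"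
    proof (rule coord_bracket_pullback[OF _ f'(1) g'(1)])
      show "toda_map n x l \<noteq> 0" if "l \<in> torus_labels n" for l
        using that toda_map_in_points[of n x] by (auto simp: P PiE_iff)
      show "((\<lambda>t. toda_map n (x(a := t)) l) has_field_derivative
           toda_log_derivative n l a * toda_map n x l) (at (x a))"
        if "l \<in> torus_labels n" "a \<in> toda_labels n" for l a
        using that by (rule toda_map_derivative)
      show "(\<Sum>a\<in>toda_labels n. \<Sum>b\<in>toda_labels n. toda_pi a b
           * (toda_log_derivative n l a * toda_map n x l) * (toda_log_derivative n l' b * toda_map n x l'))
          = torus_omega n l l' * toda_map n x l * toda_map n x l'"
        if l: "l \<in> torus_labels n" "l' \<in> torus_labels n" for l l'
        unfolding sum_toda_pi toda_map_bracket[OF l, symmetric] sum_distrib_right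
        by (intro sum.cong refl) (simp add: algebra_simps)
    qed auto
    also have "\<dots> = bracket (poisson_torus n) f g (toda_map n x)"
      unfolding bracket_poisson_torus
      using f'(2) g'(2) toda_map_in_points[of n x] unfolding P
      by (intro coord_bracket_local_cong[OF _ _ open_nonzero]) auto
    finally show ?thesis .
  qed
  ultimately show ?thesis
    unfolding poisson_map_def using toda_map_in_points by auto
qed

text \<open>For a Poisson map, compatibility of the Hamiltonian vector fields is the Poisson property
  applied to \<open>K\<close>, as soon as \<open>H\<close> may be replaced by the pullback of \<open>K\<close> inside the bracket.\<close>

lemma hamiltonian_reductionI:
  assumes "poisson_map M N F" "K \<in> funs N" "H \<in> funs M" "\<And>x. x \<in> points M \<Longrightarrow> K (F x) = H x"
    "\<And>f x. f \<in> funs N \<Longrightarrow> x \<in> points M \<Longrightarrow> bracket M H (f \<circ> F) x = bracket M (K \<circ> F) (f \<circ> F) x"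
  shows "hamiltonian_reduction M H N K F"
  using assms by (auto simp: hamiltonian_reduction_def poisson_map_def)

lemma toda_reduction:
  "hamiltonian_reduction (toda_space n) (toda_hamiltonian n 2) (poisson_torus n) (H1 n) (toda_map n)"
proof -
  have H: "toda_hamiltonian n 2 = H1 n \<circ> toda_map n"
    by (auto simp: toda_hamiltonian_eq)
  show ?thesis
    unfolding H using toda_map_is_poisson[of n] H1_in_funs[of n]
    by (intro hamiltonian_reductionI) (auto simp: poisson_map_def)
qed

text \<open>The ratios \<open>r\<^sub>i = c\<^sub>i / (4 d\<^sub>i)\<close> have to equal \<open>exp (q\<^sub>i\<^sub>+\<^sub>1 - q\<^sub>i)\<close>.  Summing logarithms of the
  \<open>r\<^sub>i\<close> from \<open>q\<^sub>0 = 0\<close> on solves this for \<open>i < n\<close>, and the last equation, from \<open>n\<close> back to \<open>0\<close>,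
  is then the condition that the product of all \<open>r\<^sub>i\<close> is \<open>1\<close>.\<close>

lemma toda_map_image:
  "toda_map n ` points (toda_space n) =
     {x \<in> points (poisson_torus n). (\<Prod>i=0..n. x (c i)) = 4 ^ (n + 1) * (\<Prod>i=0..n. x (d i))}"
proof (intro equalityI subsetI)
  fix y assume "y \<in> toda_map n ` points (toda_space n)"
  then obtain x where y: "y = toda_map n x" by auto
  have "(\<Prod>i=0..n. exp (x (q ((i + 1) mod (n + 1))))) = (\<Prod>i=0..n. exp (x (q i)))"
    using prod.reindex_bij_betw[OF bij_betw_mod_succ, of "\<lambda>i. exp (x (q i))" n] .
  then have "(\<Prod>i=0..n. y (c i)) = 4 ^ (n + 1) * (\<Prod>i=0..n. y (d i))"
    by (simp add: y toda_map_def torus_point_simps exp_add exp_diff prod.distrib prod_dividef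
        del: exp_of_nat_mult)
  then show "y \<in> {x \<in> points (poisson_torus n). (\<Prod>i=0..n. x (c i)) = 4 ^ (n + 1) * (\<Prod>i=0..n. x (d i))}"
    using toda_map_in_points by (simp add: y)
next
  fix y assume "y \<in> {x \<in> points (poisson_torus n). (\<Prod>i=0..n. x (c i)) = 4 ^ (n + 1) * (\<Prod>i=0..n. x (d i))}"
  then have y: "y \<in> points (poisson_torus n)"
    and prod: "(\<Prod>i=0..n. y (c i)) = 4 ^ (n + 1) * (\<Prod>i=0..n. y (d i))" by auto
  then have nz: "y (c i) \<noteq> 0" "y (d i) \<noteq> 0" if "i \<le> n" for i
    using that by (auto simp: points_poisson_torus PiE_iff)
  define r where "r i = y (c i) / (4 * y (d i))" for i
  have r: "r i \<noteq> 0" if "i \<le> n" for i using nz[OF that] by (simp add: r_def)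
  have "(\<Prod>i=0..n. r i) = 1"
  proof -
    have "(\<Prod>i=0..n. r i) = (\<Prod>i=0..n. y (c i)) / (4 ^ (n + 1) * (\<Prod>i=0..n. y (d i)))"
      by (simp add: r_def prod_dividef prod.distrib)
    also have "(\<Prod>i=0..n. y (d i)) \<noteq> 0" using nz by simp
    then have "(\<Prod>i=0..n. y (c i)) / (4 ^ (n + 1) * (\<Prod>i=0..n. y (d i))) = 1"
      by (simp add: prod)
    finally show ?thesis .
  qed
  then have prod_r: "r n * (\<Prod>i<n. r i) = 1"
    by (simp add: atLeast0AtMost mult.commute flip: lessThan_Suc_atMost)
  define x where "x = (\<lambda>l \<in> toda_labels n. case l of p i \<Rightarrow> Ln (y (d i)) / 2 | q i \<Rightarrow> (\<Sum>j<i. Ln (r j)))"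
  have xp: "exp (2 * x (p i)) = y (d i)" if "i \<le> n" for i
    using that nz by (simp add: x_def)
  have xq: "exp (x (q i)) = (\<Prod>j<i. r j)" if "i \<le> n" for i
    using that r by (simp add: x_def exp_sum)
  have q_ratio: "exp (x (q ((i + 1) mod (n + 1)))) / exp (x (q i)) = r i" if i: "i \<le> n" for i
  proof (cases "i = n")
    case True
    have "(\<Prod>j<n. r j) \<noteq> 0" using prod_r by (metis mult_zero_right zero_neq_one)
    then show ?thesis using True xq[of n] xq[of 0] prod_r by (simp add: divide_eq_eq)
  next
    case False
    have "(\<Prod>j<i. r j) \<noteq> 0" using r i by simp
    then show ?thesis using False xq[of i] xq[of "i + 1"] i by simp
  qed
  have "y = toda_map n x"
    unfolding toda_map_def
  proof (rule eq_torus_pointI[OF y])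
    fix i assume i: "i \<le> n"
    show "y (d i) = exp (2 * x (p i))" by (simp add: xp i)
    have "exp (2 * x (p i) - x (q i) + x (q ((i + 1) mod (n + 1))))
        = exp (2 * x (p i)) * (exp (x (q ((i + 1) mod (n + 1)))) / exp (x (q i)))"
      by (simp add: exp_add exp_diff)
    also have "\<dots> = y (d i) * r i" by (simp only: xp q_ratio i)
    finally show "y (c i) = 4 * exp (2 * x (p i) - x (q i) + x (q ((i + 1) mod (n + 1))))"
      using nz[OF i] by (simp add: r_def mult.commute[of 4])
  qed
  moreover have "x \<in> points (toda_space n)" by (simp add: points_toda x_def)
  ultimately show "y \<in> toda_map n ` points (toda_space n)" by blast
qed

section \<open>Laurent matrices as periodic matrices over the integers\<close>

text \<open>An integer \<open>a\<close> stands for the standard row vector number \<open>residue n a\<close>, multiplied by \<open>z\<close> to the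
  power \<open>winding n a\<close>.\<close>

definition residue :: "nat \<Rightarrow> int \<Rightarrow> nat" where
  "residue n a = nat (a mod int (n + 1))"

definition winding :: "nat \<Rightarrow> int \<Rightarrow> int" where
  "winding n a = a div int (n + 1)"

lemma residue_le: "residue n a \<le> n"
proof -
  have "a mod int (n + 1) < int (n + 1)" by (rule pos_mod_bound) simp
  then show ?thesis unfolding residue_def nat_le_iff by linarith
qed

lemma winding_residue: "a = winding n a * int (n + 1) + int (residue n a)"
proof -
  have "0 \<le> a mod int (n + 1)" by (rule pos_mod_sign) simp
  then show ?thesis by (simp only: residue_def winding_def nat_0_le div_mult_mod_eq)
qed

lemma residue_unique:
  assumes "i \<le> n"
  shows "residue n (k * int (n + 1) + int i) = i" "winding n (k * int (n + 1) + int i) = k"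
proof -
  have "(int i + k * int (n + 1)) mod int (n + 1) = int i"
    using assms by (simp only: mod_mult_self1) simp
  moreover have "(int i + k * int (n + 1)) div int (n + 1) = k"
    using assms by (simp only: div_mult_self1) simp
  ultimately show "residue n (k * int (n + 1) + int i) = i" "winding n (k * int (n + 1) + int i) = k"
    by (simp_all only: residue_def winding_def add.commute nat_int)
qed

lemma residue_of_nat: "i \<le> n \<Longrightarrow> residue n (int i) = i"
  using residue_unique(1)[of i n 0] by simp

lemma winding_of_nat: "i \<le> n \<Longrightarrow> winding n (int i) = 0"
  using residue_unique(2)[of i n 0] by simp

lemma residue_succ: "residue n (a + 1) = (residue n a + 1) mod (n + 1)"
proof (cases "residue n a = n")
  case True
  then have eq: "a + 1 = (winding n a + 1) * int (n + 1) + int 0"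
    using winding_residue[of a n] by (simp add: algebra_simps)
  have "residue n (a + 1) = 0" unfolding eq by (rule residue_unique) simp
  then show ?thesis using True by simp
next
  case False
  then have le: "residue n a + 1 \<le> n" using residue_le[of n a] by simp
  have eq: "a + 1 = winding n a * int (n + 1) + int (residue n a + 1)"
    using winding_residue[of a n] by (simp add: algebra_simps)
  have "residue n (a + 1) = residue n a + 1"
    using residue_unique(1)[OF le, of "winding n a"] by (simp only: eq[symmetric])
  then show ?thesis using le by simp
qed

lemma residue_succ_eq_iff:
  "i \<le> n \<Longrightarrow> residue n (a + 1) = i \<longleftrightarrow> residue n a = (i + n) mod (n + 1)"
  using mod_succ_eq_iff[OF residue_le, of i n a] by (auto simp only: residue_succ)

lemma residue_succ_neq:
  assumes "n \<ge> 1"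
  shows "residue n (a + 1) \<noteq> residue n a"
  using residue_le[of n a] assms unfolding residue_succ mod_succ[OF residue_le] by auto

text \<open>The matrix of \<open>X\<close>, acting on row vectors of Laurent polynomials, in the basis \<open>z\<^sup>w e\<^sub>r\<close> numbered
  by the integers \<open>w (n + 1) + r\<close>.  The distance \<open>b - a\<close> from the diagonal is the degree in the principal grading.\<close>

definition unroll :: "nat \<Rightarrow> laurent mat \<Rightarrow> int \<Rightarrow> int \<Rightarrow> complex" where
  "unroll n X a b =
     Poly_Mapping.lookup (X $$ (residue n a, residue n b)) (winding n b - winding n a)"

lemma unroll_one: "unroll n (1\<^sub>m (n + 1)) a b = of_bool (a = b)"
proof -
  have "a = b \<longleftrightarrow> residue n a = residue n b \<and> winding n b - winding n a = 0"
    using winding_residue[of a n] winding_residue[of b n] by auto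
  then show ?thesis
    using residue_le[of n a] residue_le[of n b]
    by (auto simp: unroll_def lookup_one when_def less_Suc_eq_le)
qed

lemma lookup_mult_int:
  fixes f g :: laurent
  assumes "finite L" "\<And>l. l \<notin> L \<Longrightarrow> Poly_Mapping.lookup f l = 0"
  shows "Poly_Mapping.lookup (f * g) k
    = (\<Sum>l\<in>L. Poly_Mapping.lookup f l * Poly_Mapping.lookup g (k - l))"
proof -
  have *: "Sum_any (\<lambda>q. Poly_Mapping.lookup g q when k = l + q) = Poly_Mapping.lookup g (k - l)" for l
  proof -
    have "k = l + q \<longleftrightarrow> q = k - l" for q :: int by auto
    then show ?thesis by simp
  qed
  show ?thesis
    unfolding lookup_mult *
  proof (rule Sum_any.expand_superset[OF assms(1)], rule subsetI, rule ccontr)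
    fix l assume "l \<notin> L" "l \<in> {l. Poly_Mapping.lookup f l * Poly_Mapping.lookup g (k - l) \<noteq> 0}"
    then show False using assms(2)[of l] by simp
  qed
qed

text \<open>Unrolling is multiplicative.  The sum over all integers has finitely many non-zero terms, and the
  finite set \<open>K\<close> may be chosen to suit the shape of the two factors.\<close>

lemma unroll_mult:
  assumes X: "X \<in> carrier_mat (n + 1) (n + 1)" and Y: "Y \<in> carrier_mat (n + 1) (n + 1)"
    and K: "finite K" "\<And>k. k \<notin> K \<Longrightarrow> unroll n X a k * unroll n Y k b = 0"
  shows "unroll n (X * Y) a b = (\<Sum>k\<in>K. unroll n X a k * unroll n Y k b)"
proof -
  let ?r = "residue n a" and ?s = "residue n b"
  define L where "L = (\<Union>t\<in>{0..<n+1}. Poly_Mapping.keys (X $$ (?r, t)))"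
  have L: "finite L" by (simp add: L_def)
  (* the integer that stands for the index t and the exponent l relative to the winding of a *)
  define pos where "pos = (\<lambda>(t, l). (winding n a + l) * int (n + 1) + int t)"
  have pos: "residue n (pos (t, l)) = t" "winding n (pos (t, l)) = winding n a + l" if "t < n + 1" for t l
    using residue_unique[of t n "winding n a + l"] that by (simp_all add: pos_def)
  have inj: "inj_on pos ({0..<n+1} \<times> L)"
  proof (rule inj_onI, clarify)
    fix t l t' l' assume "pos (t, l) = pos (t', l')" "t \<in> {0..<n+1}" "t' \<in> {0..<n+1}"
    then show "t = t' \<and> l = l'" using pos[of t l] pos[of t' l'] by auto
  qed
  have out: "unroll n X a k = 0" if "k \<notin> pos ` ({0..<n+1} \<times> L)" for k
  proof (rule ccontr)
    assume "unroll n X a k \<noteq> 0"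
    then have "winding n k - winding n a \<in> Poly_Mapping.keys (X $$ (?r, residue n k))"
      by (simp add: unroll_def in_keys_iff)
    then have "winding n k - winding n a \<in> L"
      using residue_le[of n k] by (auto simp: L_def less_Suc_eq_le)
    moreover have "k = pos (residue n k, winding n k - winding n a)"
      using winding_residue[of k n] by (simp add: pos_def)
    moreover have "residue n k \<in> {0..<n+1}" using residue_le[of n k] by simp
    ultimately show False using that by blast
  qed
  have "(X * Y) $$ (?r, ?s) = (\<Sum>t\<in>{0..<n+1}. X $$ (?r, t) * Y $$ (t, ?s))"
    using X Y residue_le[of n a] residue_le[of n b]
    by (simp add: scalar_prod_def)
  then have "unroll n (X * Y) a b = (\<Sum>t\<in>{0..<n+1}.
      Poly_Mapping.lookup (X $$ (?r, t) * Y $$ (t, ?s)) (winding n b - winding n a))"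
    by (simp only: unroll_def lookup_sum)
  also have "\<dots> = (\<Sum>t\<in>{0..<n+1}. \<Sum>l\<in>L. Poly_Mapping.lookup (X $$ (?r, t)) l
      * Poly_Mapping.lookup (Y $$ (t, ?s)) (winding n b - winding n a - l))"
    by (intro sum.cong refl lookup_mult_int L) (auto simp: L_def in_keys_iff)
  also have "\<dots> = (\<Sum>(t, l)\<in>{0..<n+1} \<times> L. Poly_Mapping.lookup (X $$ (?r, t)) l
      * Poly_Mapping.lookup (Y $$ (t, ?s)) (winding n b - winding n a - l))"
    by (rule sum.cartesian_product)
  also have "\<dots> = (\<Sum>u\<in>{0..<n+1} \<times> L. unroll n X a (pos u) * unroll n Y (pos u) b)"
    by (intro sum.cong refl) (auto simp: unroll_def pos algebra_simps)
  also have "\<dots> = (\<Sum>k\<in>pos ` ({0..<n+1} \<times> L). unroll n X a k * unroll n Y k b)"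
    by (simp only: sum.reindex[OF inj] o_def)
  also have "\<dots> = (\<Sum>k\<in>K \<union> pos ` ({0..<n+1} \<times> L). unroll n X a k * unroll n Y k b)"
    using K L out by (intro sum.mono_neutral_left) auto
  also have "\<dots> = (\<Sum>k\<in>K. unroll n X a k * unroll n Y k b)"
    using K L by (intro sum.mono_neutral_right) auto
  finally show ?thesis .
qed

text \<open>After unrolling, the affine root subgroup has the same shape as the others: the power of \<open>z\<close>
  attached to it moves its entries next to the diagonal.\<close>

lemma unroll_loop_root:
  assumes n: "n \<ge> 1" and i: "i \<le> n"
  shows "unroll n (loop_root_SL2 n i M) a b =
    (if a = b then (if residue n (a + 1) = i then M $$ (0, 0) else if residue n a = i then M $$ (1, 1) else 1)
     else if b = a + 1 \<and> residue n b = i then M $$ (0, 1)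
     else if a = b + 1 \<and> residue n a = i then M $$ (1, 0) else 0)"
proof -
  define k where "k = (i + n) mod (n + 1)"
  define e :: int where "e = (if i = 0 then 1 else 0)"
  have ik: "int i - int k = 1 - e * int (n + 1)"
    unfolding k_def mod_pred[OF i] e_def using i by auto
  have ik': "i \<noteq> k" unfolding k_def mod_pred[OF i] using n by auto
  (* the residues determine b - a up to the winding numbers, which select the power of z *)
  have ab: "b - a = (winding n b - winding n a) * int (n + 1) + (int (residue n b) - int (residue n a))"
    using winding_residue[of a n] winding_residue[of b n] by (simp add: algebra_simps)
  have succ: "residue n (a + 1) = i \<longleftrightarrow> residue n a = k" for a
    unfolding k_def by (rule residue_succ_eq_iff[OF i])
  have neq: "residue n (a + 1) \<noteq> residue n a" for a by (rule residue_succ_neq[OF n])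
  have entry: "unroll n (loop_root_SL2 n i M) a b = Poly_Mapping.lookup
     (if (residue n a, residue n b) = (k, k) then Poly_Mapping.single 0 (M $$ (0, 0))
      else if (residue n a, residue n b) = (k, i) then Poly_Mapping.single e (M $$ (0, 1))
      else if (residue n a, residue n b) = (i, k) then Poly_Mapping.single (- e) (M $$ (1, 0))
      else if (residue n a, residue n b) = (i, i) then Poly_Mapping.single 0 (M $$ (1, 1))
      else if residue n a = residue n b then 1 else 0) (winding n b - winding n a)"
    using residue_le[of n a] residue_le[of n b]
    by (simp add: unroll_def loop_root_SL2_def k_def e_def Let_def less_Suc_eq_le)
  consider "residue n a = residue n b"
    | "residue n a = k" "residue n b = i" | "residue n a = i" "residue n b = k"
    | "residue n a \<noteq> residue n b" "\<not> (residue n a = k \<and> residue n b = i)"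
      "\<not> (residue n a = i \<and> residue n b = k)"
    by blast
  then show ?thesis
  proof cases
    case 1
    then have "winding n b - winding n a = 0 \<longleftrightarrow> a = b" using ab by auto
    moreover have "b \<noteq> a + 1" "a \<noteq> b + 1" using neq 1 by metis+
    ultimately show ?thesis
      using 1 ik' unfolding entry by (auto simp: lookup_single lookup_one when_def succ)
  next
    case 2
    have "b - a - 1 = (winding n b - winding n a - e) * int (n + 1)"
      using ab ik unfolding 2 by (simp add: algebra_simps)
    then have *: "e = winding n b - winding n a \<longleftrightarrow> b = a + 1" by auto
    have 1: "a \<noteq> b" "\<not> (a = b + 1 \<and> residue n a = i)" using 2 ik' by auto
    have "unroll n (loop_root_SL2 n i M) a b = (if b = a + 1 then M $$ (0, 1) else 0)"
      unfolding entry using 2 ik' by (simp add: lookup_single when_def *)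
    moreover have "residue n a \<noteq> i" unfolding 2(1) using ik' by (rule not_sym)
    ultimately show ?thesis by (simp only: 1(1) 2(2) simp_thms if_False)
  next
    case 3
    have h: "b - a + 1 = (winding n b - winding n a + e) * int (n + 1)"
      using ab ik unfolding 3 by (simp add: algebra_simps)
    have "(winding n b - winding n a + e) * int (n + 1) = 0 \<longleftrightarrow> winding n b - winding n a + e = 0"
      by (subst mult_eq_0_iff) simp
    then have *: "- e = winding n b - winding n a \<longleftrightarrow> a = b + 1"
      unfolding h[symmetric] by presburger
    have 1: "a \<noteq> b" "\<not> (b = a + 1 \<and> residue n b = i)" using 3 ik' by auto
    have "unroll n (loop_root_SL2 n i M) a b = (if a = b + 1 then M $$ (1, 0) else 0)"
      unfolding entry using 3 ik' by (simp add: lookup_single when_def *)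
    moreover have "residue n b \<noteq> i" unfolding 3(2) using ik' by (rule not_sym)
    ultimately show ?thesis by (simp only: 1(1) 3(1) simp_thms if_False)
  next
    case 4
    then have 1: "a \<noteq> b" "\<not> (b = a + 1 \<and> residue n b = i)" "\<not> (a = b + 1 \<and> residue n a = i)"
      using succ by auto
    have "(residue n a, residue n b) \<noteq> (k, k)" "(residue n a, residue n b) \<noteq> (k, i)"
      "(residue n a, residue n b) \<noteq> (i, k)" "(residue n a, residue n b) \<noteq> (i, i)"
      using 4 by auto
    then show ?thesis
      unfolding entry by (simp only: 1 4(1) if_False lookup_zero)
  qed
qed

section \<open>Products of triangular root elements\<close>

text \<open>The diagonal entry in row \<open>a\<close> of the \<open>i\<close>-th factor, where \<open>t\<^sub>i\<close> stands in the rows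
  congruent to \<open>i - 1\<close>.\<close>

definition diag_weight :: "nat \<Rightarrow> (nat \<Rightarrow> complex) \<Rightarrow> nat \<Rightarrow> int \<Rightarrow> complex" where
  "diag_weight n t i a =
     (if residue n (a + 1) = i then t i else if residue n a = i then inverse (t i) else 1)"

definition raising :: "nat \<Rightarrow> (nat \<Rightarrow> complex) \<Rightarrow> (nat \<Rightarrow> complex) \<Rightarrow> nat \<Rightarrow> laurent mat" where
  "raising n t s i = loop_root_SL2 n i (mat2 (t i) (s i) 0 (inverse (t i)))"

definition lowering :: "nat \<Rightarrow> (nat \<Rightarrow> complex) \<Rightarrow> (nat \<Rightarrow> complex) \<Rightarrow> nat \<Rightarrow> laurent mat" where
  "lowering n t s i = loop_root_SL2 n i (mat2 (t i) 0 (s i) (inverse (t i)))"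

text \<open>The entry \<open>(a, b)\<close> of the unrolled product of the upper factors numbered by a list.  The recursion
  multiplies by one factor on the left: from \<open>a\<close> one either stays or climbs to \<open>a + 1\<close>, and the
  latter only by the factor whose number is congruent to \<open>a + 1\<close>.\<close>

fun ladder :: "nat \<Rightarrow> (nat \<Rightarrow> complex) \<Rightarrow> (nat \<Rightarrow> complex) \<Rightarrow> nat list \<Rightarrow> int \<Rightarrow> int \<Rightarrow> complex" where
  "ladder n t s [] a b = of_bool (a = b)"
| "ladder n t s (i # is) a b = diag_weight n t i a * ladder n t s is a b
     + of_bool (residue n (a + 1) = i) * s i * ladder n t s is (a + 1) b"

lemma mat2_entries:
  "mat2 a b a' b' $$ (0, 0) = a" "mat2 a b a' b' $$ (0, 1) = b"
  "mat2 a b a' b' $$ (1, 0) = a'" "mat2 a b a' b' $$ (1, 1) = b'"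
  by (simp_all add: mat2_def mat_of_rows_list_def)

lemma loop_root_carrier: "loop_root_SL2 n i M \<in> carrier_mat (n + 1) (n + 1)"
  by (simp add: loop_root_SL2_def Let_def)

lemma unroll_raising:
  assumes "n \<ge> 1" "i \<le> n"
  shows "unroll n (raising n t s i) a b =
    (if a = b then diag_weight n t i a else if b = a + 1 \<and> residue n (a + 1) = i then s i else 0)"
  unfolding raising_def unroll_loop_root[OF assms] mat2_entries diag_weight_def by auto

lemma unroll_lowering:
  assumes "n \<ge> 1" "i \<le> n"
  shows "unroll n (lowering n t s i) a b =
    (if a = b then diag_weight n t i b else if a = b + 1 \<and> residue n (b + 1) = i then s i else 0)"
  unfolding lowering_def unroll_loop_root[OF assms] mat2_entries diag_weight_def by auto

lemma raising_carrier: "raising n t s i \<in> carrier_mat (n + 1) (n + 1)"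
  by (simp only: raising_def loop_root_carrier)

lemma lowering_carrier: "lowering n t s i \<in> carrier_mat (n + 1) (n + 1)"
  by (simp only: lowering_def loop_root_carrier)

lemma unroll_raising_mult:
  assumes "n \<ge> 1" "i \<le> n" "X \<in> carrier_mat (n + 1) (n + 1)"
  shows "unroll n (raising n t s i * X) a b = diag_weight n t i a * unroll n X a b
     + of_bool (residue n (a + 1) = i) * s i * unroll n X (a + 1) b"
proof -
  have "unroll n (raising n t s i * X) a b
      = (\<Sum>k\<in>{a, a + 1}. unroll n (raising n t s i) a k * unroll n X k b)"
    by (intro unroll_mult raising_carrier assms(3)) (auto simp: unroll_raising[OF assms(1,2)])
  then show ?thesis using assms by (simp add: unroll_raising)
qed

lemma unroll_mult_lowering:
  assumes "n \<ge> 1" "i \<le> n" "X \<in> carrier_mat (n + 1) (n + 1)"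
  shows "unroll n (X * lowering n t s i) a b = diag_weight n t i b * unroll n X a b
     + of_bool (residue n (b + 1) = i) * s i * unroll n X a (b + 1)"
proof -
  have "unroll n (X * lowering n t s i) a b
      = (\<Sum>k\<in>{b, b + 1}. unroll n X a k * unroll n (lowering n t s i) k b)"
    by (intro unroll_mult lowering_carrier assms(3)) (auto simp: unroll_lowering[OF assms(1,2)])
  then show ?thesis using assms by (simp add: unroll_lowering)
qed

lemma foldr_mat_carrier:
  assumes "\<And>i. f i \<in> carrier_mat m m" "X \<in> carrier_mat m m"
  shows "foldr (\<lambda>i M. f i * M) is X \<in> carrier_mat m m"
  by (induction "is") (simp_all add: assms mult_carrier_mat[OF assms(1)])

lemma foldr_mat_mult:
  assumes "\<And>i. f i \<in> carrier_mat m m" "X \<in> carrier_mat m m"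
  shows "foldr (\<lambda>i M. f i * M) is X = foldr (\<lambda>i M. f i * M) is (1\<^sub>m m) * (X :: 'a :: semiring_1 mat)"
proof (induction "is")
  case Nil
  then show ?case using assms by simp
next
  case (Cons i "is")
  have "foldr (\<lambda>i M. f i * M) is (1\<^sub>m m) \<in> carrier_mat m m"
    using assms by (intro foldr_mat_carrier) auto
  then show ?case using Cons assms by (simp add: assoc_mult_mat[OF assms(1)])
qed

lemma unroll_raising_product:
  assumes "n \<ge> 1" "set is \<subseteq> {0..n}"
  shows "unroll n (foldr (\<lambda>i M. raising n t s i * M) is (1\<^sub>m (n + 1))) a b = ladder n t s is a b"
  using assms(2)
proof (induction "is" arbitrary: a)
  case Nil
  show ?case using unroll_one[of n a b] by simp
next
  case (Cons i "is")
  have "foldr (\<lambda>i M. raising n t s i * M) is (1\<^sub>m (n + 1)) \<in> carrier_mat (n + 1) (n + 1)"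
    by (intro foldr_mat_carrier raising_carrier one_carrier_mat)
  then show ?case
    using Cons assms(1) by (simp add: unroll_raising_mult)
qed

text \<open>Transposition turns lower factors into upper ones and reverses the order of multiplication.\<close>

lemma unroll_lowering_product:
  assumes "n \<ge> 1" "set is \<subseteq> {0..n}"
  shows "unroll n (foldr (\<lambda>i M. lowering n t s i * M) is (1\<^sub>m (n + 1))) a b
    = ladder n t s (rev is) b a"
  using assms(2)
proof (induction "is" arbitrary: b rule: rev_induct)
  case Nil
  show ?case using unroll_one[of n a b] by (simp add: eq_commute)
next
  case (snoc i "is")
  let ?f = "\<lambda>i M. lowering n t s i * M"
  note f = lowering_carrier
  have c: "foldr ?f is (1\<^sub>m (n + 1)) \<in> carrier_mat (n + 1) (n + 1)"
    by (intro foldr_mat_carrier f one_carrier_mat)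
  have "foldr ?f (is @ [i]) (1\<^sub>m (n + 1)) = foldr ?f is (1\<^sub>m (n + 1)) * lowering n t s i"
    using foldr_mat_mult[of "lowering n t s" "n + 1" "lowering n t s i" "is"]
      right_mult_one_mat[OF f, of n t s i] f by simp
  then have "unroll n (foldr ?f (is @ [i]) (1\<^sub>m (n + 1))) a b
      = diag_weight n t i b * unroll n (foldr ?f is (1\<^sub>m (n + 1))) a b
     + of_bool (residue n (b + 1) = i) * s i * unroll n (foldr ?f is (1\<^sub>m (n + 1))) a (b + 1)"
    using snoc.prems assms(1) c by (simp only:) (intro unroll_mult_lowering, auto)
  then show ?case using snoc by simp
qed

lemma ladder_below: "b < a \<Longrightarrow> ladder n t s is a b = 0"
  by (induction "is" arbitrary: a) auto

lemma ladder_diag: "ladder n t s is a a = (\<Prod>i\<leftarrow>is. diag_weight n t i a)"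
  by (induction "is") (auto simp: ladder_below)

lemma ladder_first_step:
  "a < b \<Longrightarrow> residue n (a + 1) \<notin> set is \<Longrightarrow> ladder n t s is a b = 0"
  by (induction "is") auto

text \<open>Climbing from \<open>a\<close> to \<open>a + 2\<close> or beyond uses the factors congruent to \<open>a + 1\<close> and \<open>a + 2\<close>
  one after the other, so the first must precede the second in the list.\<close>

lemma ladder_two_steps:
  assumes "a + 2 \<le> b" "sorted_wrt R is" "ladder n t s is a b \<noteq> 0"
  shows "R (residue n (a + 1)) (residue n (a + 2))"
  using assms(2,3)
proof (induction "is")
  case Nil
  then show ?case using assms(1) by auto
next
  case (Cons i "is")
  show ?case
  proof (cases "ladder n t s is a b = 0")
    case True
    then have i: "residue n (a + 1) = i" "ladder n t s is (a + 1) b \<noteq> 0"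
      using Cons.prems by auto
    then have "residue n (a + 1 + 1) \<in> set is"
      using ladder_first_step[of "a + 1" b n "is" t s] assms(1) by auto
    then show ?thesis using Cons.prems(1) i(1) by (simp add: add.assoc)
  qed (use Cons in auto)
qed

text \<open>The single step from \<open>a\<close> to \<open>a + 1\<close> is made by the factor \<open>i\<close>; the factors before it
  contribute their diagonal entries in row \<open>a\<close>, those after it their entries in row \<open>a + 1\<close>.\<close>

lemma ladder_one_step:
  assumes "i = residue n (a + 1)" "i \<notin> set xs" "i \<notin> set ys"
  shows "ladder n t s (xs @ i # ys) a (a + 1)
    = (\<Prod>k\<leftarrow>xs. diag_weight n t k a) * s i * (\<Prod>k\<leftarrow>ys. diag_weight n t k (a + 1))"
  using assms(2)
proof (induction xs)
  case Nil
  then show ?case using assms by (simp add: ladder_first_step ladder_diag)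
next
  case (Cons k xs)
  then show ?case using assms(1) by auto
qed

lemma prod_diag_weight:
  assumes "finite K" "residue n (a + 1) \<notin> K"
  shows "(\<Prod>k\<in>K. diag_weight n t k a) = (if residue n a \<in> K then inverse (t (residue n a)) else 1)"
    "(\<Prod>k\<in>K. diag_weight n t k (a + 1)) = (if residue n (a + 2) \<in> K then t (residue n (a + 2)) else 1)"
proof -
  have "(\<Prod>k\<in>K. diag_weight n t k a) = (\<Prod>k\<in>K. if k = residue n a then inverse (t k) else 1)"
    using assms(2) by (intro prod.cong refl) (auto simp: diag_weight_def)
  then show "(\<Prod>k\<in>K. diag_weight n t k a) = (if residue n a \<in> K then inverse (t (residue n a)) else 1)"
    using assms(1) by simp
  have "(\<Prod>k\<in>K. diag_weight n t k (a + 1)) = (\<Prod>k\<in>K. if k = residue n (a + 2) then t k else 1)"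
    using assms(2) by (intro prod.cong refl) (auto simp: diag_weight_def add.assoc)
  then show "(\<Prod>k\<in>K. diag_weight n t k (a + 1)) = (if residue n (a + 2) \<in> K then t (residue n (a + 2)) else 1)"
    using assms(1) by simp
qed

lemma ladder_Coxeter_diag:
  assumes "n \<ge> 1"
  shows "ladder n t s [0..<n + 1] a a = t (residue n (a + 1)) * inverse (t (residue n a))"
    "ladder n t s (rev [0..<n + 1]) a a = t (residue n (a + 1)) * inverse (t (residue n a))"
proof -
  let ?i = "residue n (a + 1)"
  have "?i \<noteq> residue n a" by (rule residue_succ_neq[OF assms])
  have "(\<Prod>k\<in>{0..<n + 1}. diag_weight n t k a)
      = diag_weight n t ?i a * (\<Prod>k\<in>{0..<n + 1} - {?i}. diag_weight n t k a)"
    using residue_le[of n "a + 1"] by (intro prod.remove) auto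
  also have "\<dots> = t ?i * inverse (t (residue n a))"
    using residue_le[of n a] residue_succ_neq[OF assms, of a]
    by (subst prod_diag_weight) (auto simp: diag_weight_def)
  finally have *: "(\<Prod>k\<in>{0..<n + 1}. diag_weight n t k a) = t ?i * inverse (t (residue n a))" .
  show "ladder n t s [0..<n + 1] a a = t ?i * inverse (t (residue n a))"
    unfolding ladder_diag *[symmetric]
    by (subst prod.distinct_set_conv_list[symmetric]) simp_all
  show "ladder n t s (rev [0..<n + 1]) a a = t ?i * inverse (t (residue n a))"
    unfolding ladder_diag *[symmetric]
    by (subst prod.distinct_set_conv_list[symmetric]) simp_all
qed

text \<open>Besides the factor \<open>i\<close> only its two neighbours \<open>j\<close> and \<open>k\<close> on the cycle have a diagonal entry
  different from \<open>1\<close> in the relevant row.  Whether they contribute depends on their position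
  before or after \<open>i\<close>; this is the source of the case distinctions in the monomials \<open>c\<^sub>i\<close>.\<close>

lemma ladder_Coxeter_one_step:
  fixes n :: nat and a :: int
  defines "j \<equiv> residue n a" and "i \<equiv> residue n (a + 1)" and "k \<equiv> residue n (a + 2)"
  shows "ladder n t s [0..<n + 1] a (a + 1)
      = (if j < i then inverse (t j) else 1) * s i * (if i < k then t k else 1)"
    "ladder n t s (rev [0..<n + 1]) a (a + 1)
      = (if i < j then inverse (t j) else 1) * s i * (if k < i then t k else 1)"
proof -
  have le: "i \<le> n" "j \<le> n" "k \<le> n" using residue_le by (auto simp: i_def j_def k_def)
  have split: "[0..<n + 1] = [0..<i] @ i # [Suc i..<n + 1]"
    using upt_add_eq_append[of 0 i "n + 1 - i"] upt_conv_Cons[of i "n + 1"] le by simp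
  have conv: "(\<Prod>k\<leftarrow>xs. f k) = (\<Prod>k\<in>set xs. f k)" if "distinct xs" for f :: "nat \<Rightarrow> complex" and xs
    using that by (simp add: prod.distinct_set_conv_list)
  show "ladder n t s [0..<n + 1] a (a + 1)
      = (if j < i then inverse (t j) else 1) * s i * (if i < k then t k else 1)"
    unfolding split using le
    by (subst ladder_one_step)
      (simp_all add: conv prod_diag_weight i_def[symmetric] j_def[symmetric] k_def[symmetric] Suc_le_eq)
  show "ladder n t s (rev [0..<n + 1]) a (a + 1)
      = (if i < j then inverse (t j) else 1) * s i * (if k < i then t k else 1)"
    unfolding split rev_append rev.simps append_assoc append.simps using le
    by (subst ladder_one_step)
      (simp_all add: conv prod_diag_weight i_def[symmetric] j_def[symmetric] k_def[symmetric] Suc_le_eq)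
qed

text \<open>The constant term of the trace is the sum of the diagonal entries over one period.\<close>

lemma trace_unroll:
  assumes "X \<in> carrier_mat (n + 1) (n + 1)"
  shows "Poly_Mapping.lookup (\<Sum>i = 0..<dim_row X. X $$ (i, i)) 0 = (\<Sum>i = 0..n. unroll n X (int i) (int i))"
proof -
  have "{0..<dim_row X} = {0..n}" using assms by auto
  then show ?thesis
    by (simp add: lookup_sum unroll_def residue_of_nat winding_of_nat)
qed

text \<open>A term with \<open>k \<ge> a + 2\<close> needs, by \<open>ladder_two_steps\<close>, the residue of \<open>a + 1\<close> to be smaller than that
  of \<open>a + 2\<close> for the upper product and larger for the lower product.\<close>

lemma unroll_raising_lowering_diag:
  fixes n :: nat and t s t' s' :: "nat \<Rightarrow> complex"
  defines "P \<equiv> foldr (\<lambda>i M. raising n t s i * M) [0..<n + 1] (1\<^sub>m (n + 1))"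
    and "Q \<equiv> foldr (\<lambda>i M. lowering n t' s' i * M) [0..<n + 1] (1\<^sub>m (n + 1))"
  assumes n: "n \<ge> 1"
  shows "unroll n (P * Q) a a
    = unroll n P a a * unroll n Q a a + unroll n P a (a + 1) * unroll n Q (a + 1) a"
proof -
  have P: "P \<in> carrier_mat (n + 1) (n + 1)" and Q: "Q \<in> carrier_mat (n + 1) (n + 1)"
    unfolding P_def Q_def
    by (intro foldr_mat_carrier raising_carrier lowering_carrier one_carrier_mat)+
  have uP: "unroll n P a b = ladder n t s [0..<n + 1] a b"
    and uQ: "unroll n Q a b = ladder n t' s' (rev [0..<n + 1]) b a" for a b
    unfolding P_def Q_def
    by (rule unroll_raising_product[OF n], force, rule unroll_lowering_product[OF n], force)
  have "unroll n (P * Q) a a = (\<Sum>k\<in>{a, a + 1}. unroll n P a k * unroll n Q k a)"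
  proof (rule unroll_mult[OF P Q])
    fix k assume k: "k \<notin> {a, a + 1}"
    show "unroll n P a k * unroll n Q k a = 0"
    proof (cases "k < a")
      case True
      then show ?thesis by (simp only: uP ladder_below mult_zero_left)
    next
      case False
      with k have k: "a + 2 \<le> k" by auto
      show ?thesis
      proof (rule ccontr)
        assume "unroll n P a k * unroll n Q k a \<noteq> 0"
        then have nz: "ladder n t s [0..<n + 1] a k \<noteq> 0" "ladder n t' s' (rev [0..<n + 1]) a k \<noteq> 0"
          by (simp_all only: uP uQ mult_eq_0_iff) auto
        have "sorted_wrt (<) [0..<n + 1]" "sorted_wrt (\<lambda>x y. y < x) (rev [0..<n + 1])"
          by (simp_all only: sorted_wrt_rev sorted_wrt_upt)
        with nz ladder_two_steps[OF k] show False by (metis less_asym)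
      qed
    qed
  qed simp
  then show ?thesis by simp
qed

section \<open>Triangular factorization in the central extension\<close>

lemma mat2_carrier: "mat2 a b a' b' \<in> carrier_mat 2 2"
  by (rule carrier_matI) (simp_all add: mat2_def mat_of_rows_list_def)

lemma mat2_upper_in_SL:
  assumes "t \<noteq> 0"
  shows "mat2 t s 0 (inverse t) \<in> carrier (SL 2)"
proof -
  have "Determinant.det (mat2 t s 0 (inverse t)) = prod_list (diag_mat (mat2 t s 0 (inverse t)))"
    by (rule det_upper_triangular[OF _ mat2_carrier])
      (auto simp: upper_triangular_def mat2_def mat_of_rows_list_def less_Suc_eq numeral_2_eq_2)
  also have "\<dots> = 1"
    using assms mat2_carrier[of t s 0 "inverse t"]
    by (simp add: diag_mat_def mat2_entries[unfolded One_nat_def] numeral_2_eq_2)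
  finally show ?thesis by (simp add: SL_def mat2_carrier)
qed

lemma mat2_lower_in_SL:
  assumes "t \<noteq> 0"
  shows "mat2 t 0 s (inverse t) \<in> carrier (SL 2)"
proof -
  have "Determinant.det (mat2 t 0 s (inverse t)) = prod_list (diag_mat (mat2 t 0 s (inverse t)))"
    by (rule det_lower_triangular[OF _ mat2_carrier])
      (auto simp: mat2_def mat_of_rows_list_def less_Suc_eq numeral_2_eq_2)
  also have "\<dots> = 1"
    using assms mat2_carrier[of t 0 s "inverse t"]
    by (simp add: diag_mat_def mat2_entries[unfolded One_nat_def] numeral_2_eq_2)
  finally show ?thesis by (simp add: SL_def mat2_carrier)
qed

lemma mat2_inverse:
  assumes "t \<noteq> 0"
  shows "mat2 (inverse t) (- s) 0 t * mat2 t s 0 (inverse t) = 1\<^sub>m 2"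
    "mat2 (inverse t) 0 (- s) t * mat2 t 0 s (inverse t) = 1\<^sub>m 2"
  using assms
  by (intro eq_matI; auto simp: mat2_def mat_of_rows_list_def scalar_prod_def less_Suc_eq numeral_2_eq_2)+

lemma loop_root_one: "loop_root_SL2 n i (1\<^sub>m 2) = 1\<^sub>m (n + 1)"
proof -
  define k where "k = (i + n) mod (n + 1)"
  define e :: int where "e = (if i = 0 then 1 else 0)"
  have entries: "(1\<^sub>m 2 :: complex mat) $$ (0, 0) = 1" "(1\<^sub>m 2 :: complex mat) $$ (0, 1) = 0"
    "(1\<^sub>m 2 :: complex mat) $$ (1, 0) = 0" "(1\<^sub>m 2 :: complex mat) $$ (1, 1) = 1" by simp_all
  have M: "loop_root_SL2 n i (1\<^sub>m 2) = Matrix.mat (n + 1) (n + 1) (\<lambda>(r, s).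
       if (r, s) = (k, k) then 1 else if (r, s) = (k, i) then 0
       else if (r, s) = (i, k) then 0 else if (r, s) = (i, i) then 1 else if r = s then 1 else 0)"
    unfolding loop_root_SL2_def Let_def entries single_zero single_one k_def ..
  have "(if (r, s) = (k, k) then 1 else if (r, s) = (k, i) then 0
       else if (r, s) = (i, k) then 0 else if (r, s) = (i, i) then 1 else if r = s then 1 else 0)
       = (if r = s then 1 else 0 :: laurent)" for r s
    by (cases "r = s"; cases "r = k"; cases "s = i") simp_all
  then show ?thesis unfolding M
    by (intro eq_matI) (simp_all only: index_mat split_conv index_one_mat dim_row_mat dim_col_mat)
qed

context central_loop_extension
begin

lemma pr_mult:
  assumes "x \<in> carrier G" "y \<in> carrier G"
  shows "pr (x \<otimes> y) = pr x * pr y"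
  using hom_mult[OF pr_hom assms] by (simp add: SL_def)

lemma pr_carrier: "x \<in> carrier G \<Longrightarrow> pr x \<in> carrier_mat (n + 1) (n + 1)"
  using hom_in_carrier[OF pr_hom, of x] by (simp add: SL_def)

lemma root_one:
  assumes "i \<le> n"
  shows "\<phi> i (1\<^sub>m 2) = \<one>"
proof -
  have o: "1\<^sub>m 2 \<in> carrier (SL 2)" by (simp add: SL_def)
  have c: "\<phi> i (1\<^sub>m 2) \<in> carrier G" by (rule hom_in_carrier[OF root_hom[OF assms] o])
  have "\<phi> i (1\<^sub>m 2) \<otimes> \<phi> i (1\<^sub>m 2) = \<phi> i (1\<^sub>m 2)"
    using hom_mult[OF root_hom[OF assms] o o] by (simp add: SL_def)
  then show ?thesis using c by (simp only: l_cancel_one)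
qed

lemma pr_one: "pr \<one> = 1\<^sub>m (n + 1)"
  using root_lift[of 0 "1\<^sub>m 2"] root_one[of 0] by (simp add: loop_root_one SL_def)

lemma root_inverse:
  assumes "i \<le> n" "M \<in> carrier (SL 2)" "M' \<in> carrier (SL 2)" "M' * M = 1\<^sub>m 2"
  shows "inv (\<phi> i M) = \<phi> i M'"
proof (rule inv_equality)
  show "\<phi> i M' \<otimes> \<phi> i M = \<one>"
    using hom_mult[OF root_hom[OF assms(1)] assms(3,2)] assms(4) root_one[OF assms(1)]
    by (simp add: SL_def)
  show "\<phi> i M \<in> carrier G" "\<phi> i M' \<in> carrier G"
    using hom_in_carrier[OF root_hom[OF assms(1)]] assms(2,3) by auto
qed

lemma foldr_carrier:
  "(\<And>i. i \<in> set is \<Longrightarrow> f i \<in> carrier G) \<Longrightarrow> foldr (\<lambda>i y. f i \<otimes> y) is \<one> \<in> carrier G"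
  by (induction "is") auto

lemma pr_foldr:
  assumes "\<And>i. i \<in> set is \<Longrightarrow> f i \<in> carrier G" "\<And>i. i \<in> set is \<Longrightarrow> pr (f i) = g i"
  shows "pr (foldr (\<lambda>i y. f i \<otimes> y) is \<one>) = foldr (\<lambda>i M. g i * M) is (1\<^sub>m (n + 1))"
  using assms by (induction "is") (auto simp: pr_one pr_mult foldr_carrier)

text \<open>Triangularity after unrolling describes the positive Borel subgroup of the loop group, namely the
  matrices that are polynomial in \<open>z\<close> and upper triangular at \<open>z = 0\<close>; \<open>lower\<close> belongs in the same
  way to the negative one.  Inverses are controlled separately, by \<open>foldr_with_inverse\<close>.\<close>

definition upper :: "'g set" where
  "upper = {x \<in> carrier G. \<forall>a b. b < a \<longrightarrow> unroll n (pr x) a b = 0}"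

definition lower :: "'g set" where
  "lower = {x \<in> carrier G. \<forall>a b. a < b \<longrightarrow> unroll n (pr x) a b = 0}"

lemma upper_mult:
  assumes "x \<in> upper" "y \<in> upper"
  shows "x \<otimes> y \<in> upper"
proof -
  have c: "x \<in> carrier G" "y \<in> carrier G" using assms by (auto simp: upper_def)
  have "unroll n (pr x * pr y) a b = (\<Sum>k\<in>{}. unroll n (pr x) a k * unroll n (pr y) k b)"
    if "b < a" for a b
  proof (rule unroll_mult[OF pr_carrier[OF c(1)] pr_carrier[OF c(2)]])
    fix k show "unroll n (pr x) a k * unroll n (pr y) k b = 0"
      using assms that by (cases "k < a") (auto simp: upper_def)
  qed simp
  then show ?thesis using c by (simp add: upper_def pr_mult)
qed

lemma lower_mult:
  assumes "x \<in> lower" "y \<in> lower"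
  shows "x \<otimes> y \<in> lower"
proof -
  have c: "x \<in> carrier G" "y \<in> carrier G" using assms by (auto simp: lower_def)
  have "unroll n (pr x * pr y) a b = (\<Sum>k\<in>{}. unroll n (pr x) a k * unroll n (pr y) k b)"
    if "a < b" for a b
  proof (rule unroll_mult[OF pr_carrier[OF c(1)] pr_carrier[OF c(2)]])
    fix k show "unroll n (pr x) a k * unroll n (pr y) k b = 0"
      using assms that by (cases "a < k") (auto simp: lower_def)
  qed simp
  then show ?thesis using c by (simp add: lower_def pr_mult)
qed

text \<open>The inverse of a product is the product of the inverses in reverse order, so membership in a
  submonoid has to be tracked for factors and inverses together.\<close>

lemma foldr_with_inverse:
  assumes U: "\<And>x y. x \<in> U \<Longrightarrow> y \<in> U \<Longrightarrow> x \<otimes> y \<in> U" "\<one> \<in> U"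
    and f: "\<And>i. i \<in> set is \<Longrightarrow> f i \<in> carrier G \<and> f i \<in> U \<and> inv (f i) \<in> U"
  shows "foldr (\<lambda>i y. f i \<otimes> y) is \<one> \<in> U \<and> inv (foldr (\<lambda>i y. f i \<otimes> y) is \<one>) \<in> U"
  using f
proof (induction "is")
  case Nil
  show ?case using U(2) by simp
next
  case (Cons i "is")
  have "foldr (\<lambda>i y. f i \<otimes> y) is \<one> \<in> carrier G"
    using Cons.prems by (intro foldr_carrier) auto
  then show ?case using Cons by (auto simp: inv_mult_group U(1))
qed

lemma one_triangular: "\<one> \<in> upper" "\<one> \<in> lower"
  using unroll_one[of n] by (auto simp: upper_def lower_def pr_one)

text \<open>The element \<open>x'\<^sup>-\<^sup>1 x = z' z\<^sup>-\<^sup>1\<close> is upper and lower triangular at once, so its image in the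
  loop group is diagonal; \<open>h\<close> is its diagonal.\<close>

lemma triangular_factorization_unique:
  assumes G: "x \<in> carrier G" "x' \<in> carrier G" "z \<in> carrier G" "z' \<in> carrier G"
    and eq: "x \<otimes> z = x' \<otimes> z'"
    and up: "x \<in> upper" "inv x' \<in> upper" and low: "z' \<in> lower" "inv z \<in> lower"
  obtains h where "\<And>a b. unroll n (pr x) a b = unroll n (pr x') a b * h b"
    and "\<And>a b. unroll n (pr z') a b = h a * unroll n (pr z) a b"
proof -
  define g where "g = inv x' \<otimes> x"
  have g: "g \<in> carrier G" using G by (simp add: g_def)
  have x: "x = x' \<otimes> g" using G by (simp add: g_def flip: m_assoc)
  have "g \<otimes> z = inv x' \<otimes> (x \<otimes> z)" using G by (simp add: g_def m_assoc)
  then have z': "z' = g \<otimes> z" using G by (simp add: eq flip: m_assoc)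
  have g': "g = z' \<otimes> inv z" using G g by (simp add: z' m_assoc)
  have "g \<in> upper" unfolding g_def using up by (simp add: upper_mult)
  moreover have "g \<in> lower" unfolding g' using low by (simp add: lower_mult)
  ultimately have diag: "unroll n (pr g) a b = 0" if "a \<noteq> b" for a b
    using that by (cases "a < b") (auto simp: upper_def lower_def)
  (* g is triangular in both directions, so only this diagonal is left *)
  define h where "h a = unroll n (pr g) a a" for a
  have "unroll n (pr x' * pr g) a b = (\<Sum>k\<in>{b}. unroll n (pr x') a k * unroll n (pr g) k b)" for a b
    using G g diag by (intro unroll_mult pr_carrier) auto
  then have 1: "unroll n (pr x) a b = unroll n (pr x') a b * h b" for a b
    unfolding x using G g by (simp add: pr_mult h_def)
  have "unroll n (pr g * pr z) a b = (\<Sum>k\<in>{a}. unroll n (pr g) a k * unroll n (pr z) k b)" for a b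
    using G g diag by (intro unroll_mult pr_carrier) auto
  then have "unroll n (pr z') a b = h a * unroll n (pr z) a b" for a b
    unfolding z' using G g by (simp add: pr_mult h_def)
  with 1 show thesis by (rule that)
qed

end

section \<open>Factorization coordinates on the double Bruhat cell\<close>

abbreviation cell_labels :: "nat \<Rightarrow> cell_label set" where
  "cell_labels n \<equiv> A ` {0..n} \<union> B ` {0..n} \<union> C ` {0..n} \<union> D ` {0..n}"

lemma points_cell: "points (cell_coords n) = cell_labels n \<rightarrow>\<^sub>E (- {0})"
  and funs_cell: "funs (cell_coords n) =
    {f. \<exists>g\<in>laurent_polys (cell_labels n). \<forall>x\<in>points (cell_coords n). f x = g x}"
  and bracket_cell: "bracket (cell_coords n) =
    coord_bracket (cell_labels n) (\<lambda>a b x. cell_omega a b * x a * x b)"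
  by (simp_all add: cell_coords_def log_canonical_torus_def)

lemma cell_point_nonzero:
  assumes "y \<in> points (cell_coords n)" "i \<le> n"
  shows "y (A i) \<noteq> 0" "y (B i) \<noteq> 0" "y (C i) \<noteq> 0" "y (D i) \<noteq> 0"
  using assms by (auto simp: points_cell PiE_iff)

text \<open>The functions \<open>T\<^sub>i / T\<^sub>i\<^sub>-\<^sub>1\<close> and \<open>S\<^sub>i T\<^sub>i / T\<^sub>i\<^sub>-\<^sub>1\<close> as reduced Laurent monomials in the
  factorization coordinates; see \<open>cell_c_eq\<close> for the second.\<close>

definition cell_d :: "nat \<Rightarrow> nat \<Rightarrow> (cell_label \<Rightarrow> complex) \<Rightarrow> complex" where
  "cell_d n i y = (let j = (i + n) mod (n + 1) in
     y (A i) * inverse (y (A j)) * inverse (y (D i)) * y (D j))"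

definition cell_c :: "nat \<Rightarrow> nat \<Rightarrow> (cell_label \<Rightarrow> complex) \<Rightarrow> complex" where
  "cell_c n i y = (let j = (i + n) mod (n + 1); k = (i + 1) mod (n + 1) in
     y (B i) * y (C i) * (if j < i then inverse (y (A j)) else y (D j))
       * (if i < k then y (A k) else inverse (y (D k))))"

definition cell_map :: "nat \<Rightarrow> (cell_label \<Rightarrow> complex) \<Rightarrow> torus_label \<Rightarrow> complex" where
  "cell_map n y = torus_point n (\<lambda>i. cell_c n i y) (\<lambda>i. cell_d n i y)"

definition raising_product :: "nat \<Rightarrow> (cell_label \<Rightarrow> complex) \<Rightarrow> laurent mat" where
  "raising_product n y =
     foldr (\<lambda>i M. raising n (\<lambda>i. y (A i)) (\<lambda>i. y (B i)) i * M) [0..<n + 1] (1\<^sub>m (n + 1))"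

definition lowering_product :: "nat \<Rightarrow> (cell_label \<Rightarrow> complex) \<Rightarrow> laurent mat" where
  "lowering_product n y =
     foldr (\<lambda>i M. lowering n (\<lambda>i. inverse (y (D i))) (\<lambda>i. y (C i)) i * M) [0..<n + 1] (1\<^sub>m (n + 1))"

lemma residue_pred: "(residue n (a + 1) + n) mod (n + 1) = residue n a"
  using iffD1[OF residue_succ_eq_iff[OF residue_le[of n "a + 1"], of a] refl] by (rule sym)

lemma residue_succ2: "(residue n (a + 1) + 1) mod (n + 1) = residue n (a + 2)"
  using residue_succ[of n "a + 1"] by (simp add: add.assoc)

lemma unroll_products:
  assumes "n \<ge> 1"
  shows "unroll n (raising_product n y) a b = ladder n (\<lambda>i. y (A i)) (\<lambda>i. y (B i)) [0..<n + 1] a b"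
    "unroll n (lowering_product n y) a b
       = ladder n (\<lambda>i. inverse (y (D i))) (\<lambda>i. y (C i)) (rev [0..<n + 1]) b a"
  unfolding raising_product_def lowering_product_def
  by (rule unroll_raising_product[OF assms], force, rule unroll_lowering_product[OF assms], force)

lemma cell_d_unroll:
  assumes "n \<ge> 1"
  shows "cell_d n (residue n (a + 1)) y
    = unroll n (raising_product n y) a a * unroll n (lowering_product n y) a a"
  unfolding unroll_products[OF assms] ladder_Coxeter_diag[OF assms] cell_d_def Let_def residue_pred
  by simp

lemma cell_c_unroll:
  assumes "n \<ge> 1"
  shows "cell_c n (residue n (a + 1)) y
    = unroll n (raising_product n y) a (a + 1) * unroll n (lowering_product n y) (a + 1) a"
proof -
  have "residue n (a + 1) \<noteq> residue n a" "residue n (a + 2) \<noteq> residue n (a + 1)"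
    using residue_succ_neq[OF assms, of a] residue_succ_neq[OF assms, of "a + 1"]
    by (simp_all add: add.assoc)
  then show ?thesis
    unfolding unroll_products[OF assms] ladder_Coxeter_one_step cell_c_def Let_def residue_pred residue_succ2
    by auto
qed

text \<open>Both neighbours of \<open>i\<close> contribute separately: for \<open>n = 1\<close> they coincide and the Cartan integer
  is \<open>-2\<close>.\<close>

lemma powi_cartan:
  fixes x :: complex
  assumes "x \<noteq> 0" "k \<noteq> i" "k \<le> n" "i \<le> n"
  shows "x powi cartan n k i
      = (if k = (i + n) mod (n + 1) then inverse x else 1) * (if k = (i + 1) mod (n + 1) then inverse x else 1)"
    "x powi (- cartan n k i)
      = (if k = (i + n) mod (n + 1) then x else 1) * (if k = (i + 1) mod (n + 1) then x else 1)"
proof -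
  have c: "cartan n k i = - of_bool (k = (i + n) mod (n + 1)) - of_bool (k = (i + 1) mod (n + 1))"
    using assms(2) mod_succ_eq_iff[OF assms(3,4)] by (simp add: cartan_def)
  show "x powi cartan n k i
      = (if k = (i + n) mod (n + 1) then inverse x else 1) * (if k = (i + 1) mod (n + 1) then inverse x else 1)"
    unfolding c using assms(1)
    by (simp add: power_int_minus power_int_diff field_simps power2_eq_square del: One_nat_def)
  show "x powi (- cartan n k i)
      = (if k = (i + n) mod (n + 1) then x else 1) * (if k = (i + 1) mod (n + 1) then x else 1)"
    unfolding c using assms(1)
    by (simp add: power_int_minus power_int_diff field_simps power2_eq_square del: One_nat_def)
qed

lemma prod_delta_if:
  fixes f :: "nat \<Rightarrow> complex"
  assumes "finite K"
  shows "(\<Prod>k\<in>K. (if k = j then f k else 1) * (if k = l then f k else 1))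
    = (if j \<in> K then f j else 1) * (if l \<in> K then f l else 1)"
  using assms by (simp add: prod.distrib)

text \<open>The left-hand side is \<open>S\<^sub>i T\<^sub>i / T\<^sub>i\<^sub>-\<^sub>1\<close> written out.  Every neighbour of \<open>i\<close> occurs in exactly one of
  the two products; the factor \<open>T\<^sub>i\<^sub>-\<^sub>1\<close> cancels against the contribution of the predecessor \<open>j\<close>.\<close>

lemma cell_c_eq:
  assumes n: "n \<ge> 1" and y: "y \<in> points (cell_coords n)" and i: "i \<le> n"
  defines "j \<equiv> (i + n) mod (n + 1)"
  shows "y (B i) * y (D i) * (\<Prod>k\<in>{0..<i}. y (D k) powi cartan n k i)
      * ((\<Prod>k\<in>{i<..n}. y (A k) powi (- cartan n k i)) * inverse (y (A i)) * y (C i))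
      * (y (A i) * inverse (y (D i))) * inverse (y (A j) * inverse (y (D j)))
    = cell_c n i y"
proof -
  obtain k where k: "k = (i + 1) mod (n + 1)" by blast
  have le: "j \<le> n" "k \<le> n" by (simp_all only: j_def k mod_le)
  have ne: "j \<noteq> i" "k \<noteq> i"
    using n i unfolding j_def k mod_pred[OF i] mod_succ[OF i] by auto
  note nz = cell_point_nonzero[OF y]
  have D: "(\<Prod>m\<in>{0..<i}. y (D m) powi cartan n m i)
      = (if j < i then inverse (y (D j)) else 1) * (if k < i then inverse (y (D k)) else 1)"
  proof -
    have "(\<Prod>m\<in>{0..<i}. y (D m) powi cartan n m i) = (\<Prod>m\<in>{0..<i}.
        (if m = j then inverse (y (D m)) else 1) * (if m = k then inverse (y (D m)) else 1))"
      using i nz unfolding j_def k by (intro prod.cong refl powi_cartan(1)) auto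
    then show ?thesis by (simp add: prod_delta_if)
  qed
  have A: "(\<Prod>m\<in>{i<..n}. y (A m) powi (- cartan n m i))
      = (if i < j then y (A j) else 1) * (if i < k then y (A k) else 1)"
  proof -
    have "(\<Prod>m\<in>{i<..n}. y (A m) powi (- cartan n m i)) = (\<Prod>m\<in>{i<..n}.
        (if m = j then y (A m) else 1) * (if m = k then y (A m) else 1))"
      using i nz unfolding j_def k by (intro prod.cong refl powi_cartan(2)) auto
    then show ?thesis using le by (simp add: prod_delta_if)
  qed
  have c: "cell_c n i y = y (B i) * y (C i) * (if j < i then inverse (y (A j)) else y (D j))
       * (if i < k then y (A k) else inverse (y (D k)))"
    unfolding cell_c_def Let_def j_def k ..
  show ?thesis
    unfolding A D c using nz[OF i] nz[OF le(1)] nz[OF le(2)] ne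
    by (cases "j < i"; cases "k < i") (simp_all add: field_simps)
qed

lemma coxeter_toda_map_eq:
  assumes "n \<ge> 1" "factors n G \<phi> x \<in> points (cell_coords n)"
  shows "coxeter_toda_map n G \<phi> x = cell_map n (factors n G \<phi> x)"
proof -
  have "S n G \<phi> i x * T n G \<phi> i x * inverse (T n G \<phi> ((i + n) mod (n + 1)) x)
      = cell_c n i (factors n G \<phi> x)" if "i \<le> n" for i
    using cell_c_eq[OF assms that] by (simp only: S_def V_def W_def T_def Let_def)
  moreover have "T n G \<phi> i x * inverse (T n G \<phi> ((i + n) mod (n + 1)) x)
      = cell_d n i (factors n G \<phi> x)" for i
    by (simp add: T_def cell_d_def Let_def mult_ac)
  ultimately show ?thesis
    unfolding coxeter_toda_map_def cell_map_def torus_point_def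
    by (intro restrict_ext) (auto split: torus_label.split)
qed

context central_loop_extension
begin

lemma raising_in_upper:
  assumes "n \<ge> 1" "i \<le> n" "t \<noteq> 0"
  shows "\<phi> i (mat2 t s 0 (inverse t)) \<in> upper"
proof -
  have "pr (\<phi> i (mat2 t s 0 (inverse t))) = raising n (\<lambda>_. t) (\<lambda>_. s) i"
    unfolding raising_def by (rule root_lift[OF assms(2) mat2_upper_in_SL[OF assms(3)]])
  then show ?thesis
    using hom_in_carrier[OF root_hom[OF assms(2)] mat2_upper_in_SL[OF assms(3)]]
    by (auto simp: upper_def unroll_raising[OF assms(1,2)])
qed

lemma lowering_in_lower:
  assumes "n \<ge> 1" "i \<le> n" "t \<noteq> 0"
  shows "\<phi> i (mat2 t 0 s (inverse t)) \<in> lower"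
proof -
  have "pr (\<phi> i (mat2 t 0 s (inverse t))) = lowering n (\<lambda>_. t) (\<lambda>_. s) i"
    unfolding lowering_def by (rule root_lift[OF assms(2) mat2_lower_in_SL[OF assms(3)]])
  then show ?thesis
    using hom_in_carrier[OF root_hom[OF assms(2)] mat2_lower_in_SL[OF assms(3)]]
    by (auto simp: lower_def unroll_lowering[OF assms(1,2)])
qed

text \<open>The two halves of a factorization and their images in the loop group, together with the fact that
  their inverses are triangular as well.\<close>

lemma factorization_parts:
  assumes n: "n \<ge> 1" and y: "y \<in> points (cell_coords n)"
  obtains x z where "x \<in> carrier G" "z \<in> carrier G" "factorization n G \<phi> y = x \<otimes> z"
    "x \<in> upper" "inv x \<in> upper" "z \<in> lower" "inv z \<in> lower"
    "pr x = raising_product n y" "pr z = lowering_product n y"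
proof -
  define f where "f i = \<phi> i (mat2 (y (A i)) (y (B i)) 0 (inverse (y (A i))))" for i
  define g where "g i = \<phi> i (mat2 (inverse (y (D i))) 0 (y (C i)) (inverse (inverse (y (D i)))))" for i
  define x where "x = foldr (\<lambda>i y. f i \<otimes> y) [0..<n + 1] \<one>"
  define z where "z = foldr (\<lambda>i y. g i \<otimes> y) [0..<n + 1] \<one>"
  have le: "i \<le> n" if "i \<in> set [0..<n + 1]" for i using that by auto
  note nz = cell_point_nonzero[OF y]
  have f: "f i \<in> carrier G" "f i \<in> upper" "inv (f i) \<in> upper"
    "pr (f i) = raising n (\<lambda>i. y (A i)) (\<lambda>i. y (B i)) i" if i: "i \<le> n" for i
  proof -
    let ?a = "y (A i)"
    have inv: "inv (f i) = \<phi> i (mat2 (inverse ?a) (- y (B i)) 0 (inverse (inverse ?a)))"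
      unfolding f_def using nz[OF i] mat2_inverse(1)[of ?a "y (B i)"]
      by (intro root_inverse i mat2_upper_in_SL) simp_all
    show "f i \<in> upper" "inv (f i) \<in> upper"
      unfolding inv unfolding f_def using nz[OF i] by (intro raising_in_upper n i; simp)+
    then show "f i \<in> carrier G" by (simp add: upper_def)
    show "pr (f i) = raising n (\<lambda>i. y (A i)) (\<lambda>i. y (B i)) i"
      unfolding f_def raising_def using nz[OF i] by (intro root_lift i mat2_upper_in_SL)
  qed
  have g: "g i \<in> carrier G" "g i \<in> lower" "inv (g i) \<in> lower"
    "pr (g i) = lowering n (\<lambda>i. inverse (y (D i))) (\<lambda>i. y (C i)) i" if i: "i \<le> n" for i
  proof -
    let ?a = "inverse (y (D i))"
    have a: "?a \<noteq> 0" using nz[OF i] by simp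
    have inv: "inv (g i) = \<phi> i (mat2 (inverse ?a) 0 (- y (C i)) (inverse (inverse ?a)))"
      unfolding g_def using a mat2_inverse(2)[of ?a "y (C i)"]
      by (intro root_inverse i mat2_lower_in_SL) simp_all
    show "g i \<in> lower" "inv (g i) \<in> lower"
      unfolding inv unfolding g_def using a by (intro lowering_in_lower n i; simp)+
    then show "g i \<in> carrier G" by (simp add: lower_def)
    show "pr (g i) = lowering n (\<lambda>i. inverse (y (D i))) (\<lambda>i. y (C i)) i"
      unfolding g_def lowering_def using a by (intro root_lift i mat2_lower_in_SL)
  qed
  have "x \<in> upper \<and> inv x \<in> upper"
    unfolding x_def using f le by (intro foldr_with_inverse upper_mult one_triangular) auto
  moreover have "z \<in> lower \<and> inv z \<in> lower"
    unfolding z_def using g le by (intro foldr_with_inverse lower_mult one_triangular) auto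
  moreover have "factorization n G \<phi> y = x \<otimes> z"
    unfolding factorization_def ordered_prod_def x_def z_def f_def g_def inverse_inverse_eq ..
  moreover have "pr x = raising_product n y"
    unfolding x_def raising_product_def by (rule pr_foldr) (erule f(1)[OF le], erule f(4)[OF le])
  moreover have "pr z = lowering_product n y"
    unfolding z_def lowering_product_def by (rule pr_foldr) (erule g(1)[OF le], erule g(4)[OF le])
  moreover have "x \<in> carrier G"
    unfolding x_def by (rule foldr_carrier) (erule f(1)[OF le])
  moreover have "z \<in> carrier G"
    unfolding z_def by (rule foldr_carrier) (erule g(1)[OF le])
  ultimately show thesis by (intro that[of x z]) blast+
qed

text \<open>Replacing \<open>(P, Q)\<close> by \<open>(P h\<^sup>-\<^sup>1, h Q)\<close> with \<open>h\<close> diagonal does not change the products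
  \<open>P(a, b) Q(b, a)\<close>, and \<open>c\<^sub>i\<close> and \<open>d\<^sub>i\<close> are of this form.\<close>

lemma cell_map_fibre:
  assumes n: "n \<ge> 1" and y: "y \<in> points (cell_coords n)" and y': "y' \<in> points (cell_coords n)"
    and eq: "factorization n G \<phi> y = factorization n G \<phi> y'"
  shows "cell_map n y = cell_map n y'"
proof -
  obtain x z where x: "x \<in> carrier G" "z \<in> carrier G" "factorization n G \<phi> y = x \<otimes> z"
    "x \<in> upper" "inv x \<in> upper" "z \<in> lower" "inv z \<in> lower"
    "pr x = raising_product n y" "pr z = lowering_product n y"
    by (rule factorization_parts[OF n y])
  obtain x' z' where x': "x' \<in> carrier G" "z' \<in> carrier G" "factorization n G \<phi> y' = x' \<otimes> z'"
    "x' \<in> upper" "inv x' \<in> upper" "z' \<in> lower" "inv z' \<in> lower"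
    "pr x' = raising_product n y'" "pr z' = lowering_product n y'"
    by (rule factorization_parts[OF n y'])
  have "x \<otimes> z = x' \<otimes> z'" using eq x(3) x'(3) by simp
  then obtain h where
    h: "\<And>a b. unroll n (raising_product n y) a b = unroll n (raising_product n y') a b * h b"
      "\<And>a b. unroll n (lowering_product n y') a b = h a * unroll n (lowering_product n y) a b"
    using triangular_factorization_unique[OF x(1) x'(1) x(2) x'(2) _ x(4) x'(5) x'(6) x(7)]
    unfolding x(8,9) x'(8,9) by blast
  have ratio: "cell_d n (residue n (a + 1)) y = cell_d n (residue n (a + 1)) y'"
    "cell_c n (residue n (a + 1)) y = cell_c n (residue n (a + 1)) y'" for a
    unfolding cell_d_unroll[OF n] cell_c_unroll[OF n] h(1)[of a] h(2)[of _ a]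
    by (simp_all only: mult.assoc)
  have "cell_d n i y = cell_d n i y'" "cell_c n i y = cell_c n i y'" if "i \<le> n" for i
    using ratio[of "int i - 1"] residue_of_nat[OF that] by simp_all
  then show ?thesis
    unfolding cell_map_def torus_point_def
    by (intro restrict_ext) (auto split: torus_label.split)
qed

lemma coxeter_toda_hamiltonian_factorization:
  assumes n: "n \<ge> 1" and y: "y \<in> points (cell_coords n)"
  shows "coxeter_toda_hamiltonian pr (factorization n G \<phi> y) = H1 n (cell_map n y)"
proof -
  obtain x z where x: "x \<in> carrier G" "z \<in> carrier G" "factorization n G \<phi> y = x \<otimes> z"
    "pr x = raising_product n y" "pr z = lowering_product n y"
    by (rule factorization_parts[OF n y])
  have "coxeter_toda_hamiltonian pr (factorization n G \<phi> y)
      = (\<Sum>r = 0..n. unroll n (raising_product n y * lowering_product n y) (int r) (int r))"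
    unfolding coxeter_toda_hamiltonian_def evaluation_character_def
    using trace_unroll[OF pr_carrier, of "x \<otimes> z"] x pr_mult[of x z] by simp
  also have "\<dots> = (\<Sum>r = 0..n. cell_d n (residue n (int r + 1)) y + cell_c n (residue n (int r + 1)) y)"
    unfolding cell_d_unroll[OF n] cell_c_unroll[OF n]
    unfolding raising_product_def lowering_product_def unroll_raising_lowering_diag[OF n] ..
  also have "\<dots> = (\<Sum>r = 0..n. cell_d n ((r + 1) mod (n + 1)) y + cell_c n ((r + 1) mod (n + 1)) y)"
    by (intro sum.cong refl) (simp only: residue_succ residue_of_nat atLeastAtMost_iff)
  also have "\<dots> = (\<Sum>i = 0..n. cell_d n i y + cell_c n i y)"
    by (rule sum.reindex_bij_betw[OF bij_betw_mod_succ])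
  also have "\<dots> = H1 n (cell_map n y)"
    by (simp add: cell_map_def H1_torus_point add.commute)
  finally show ?thesis .
qed

end

section \<open>The torus map in factorization coordinates\<close>

text \<open>A unit of the Laurent ring whose logarithmic derivatives \<open>x\<^sub>a \<partial>f/\<partial>x\<^sub>a / f\<close> are the constants
  \<open>m a\<close>, that is, a scalar multiple of the monomial with exponents \<open>m\<close>.\<close>

definition laurent_monomial ::
  "'l set \<Rightarrow> ('l \<Rightarrow> complex) \<Rightarrow> (('l \<Rightarrow> complex) \<Rightarrow> complex) \<Rightarrow> bool" where
  "laurent_monomial J m f \<longleftrightarrow>
     f \<in> laurent_polys J \<and> (\<lambda>x. inverse (f x)) \<in> laurent_polys J \<and>
     (\<forall>x. (\<forall>a\<in>J. x a \<noteq> 0) \<longrightarrow> f x \<noteq> 0 \<and>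
       (\<forall>a\<in>J. ((\<lambda>t. f (x(a := t))) has_field_derivative m a * f x / x a) (at (x a))))"

lemma laurent_monomial_coord:
  assumes "b \<in> J"
  shows "laurent_monomial J (\<lambda>a. of_bool (a = b)) (\<lambda>x. x b)"
proof -
  have "((\<lambda>t. (x(a := t)) b) has_field_derivative of_bool (a = b) * x b / x a) (at (x a))"
    if "x a \<noteq> 0" for x :: "'a \<Rightarrow> complex" and a
    using that by (cases "a = b") auto
  then show ?thesis
    unfolding laurent_monomial_def
    using laurent_polys.coord[OF assms] laurent_polys.coord_inv[OF assms] assms by auto
qed

lemma laurent_monomial_mult:
  assumes "laurent_monomial J m f" "laurent_monomial J m' g"
  shows "laurent_monomial J (\<lambda>a. m a + m' a) (\<lambda>x. f x * g x)"
proof -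
  have "((\<lambda>t. f (x(a := t)) * g (x(a := t))) has_field_derivative
      (m a + m' a) * (f x * g x) / x a) (at (x a))" if "\<forall>a\<in>J. x a \<noteq> 0" "a \<in> J" for x a
  proof -
    have "((\<lambda>t. f (x(a := t))) has_field_derivative m a * f x / x a) (at (x a))"
      "((\<lambda>t. g (x(a := t))) has_field_derivative m' a * g x / x a) (at (x a))"
      using assms that unfolding laurent_monomial_def by blast+
    from DERIV_mult[OF this] show ?thesis
      by (rule DERIV_cong) (simp add: add_divide_distrib algebra_simps)
  qed
  then show ?thesis
    using assms unfolding laurent_monomial_def
    by (auto intro: laurent_polys.mult simp: inverse_mult_distrib)
qed

lemma laurent_monomial_inverse:
  assumes "laurent_monomial J m f"
  shows "laurent_monomial J (\<lambda>a. - m a) (\<lambda>x. inverse (f x))"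
proof -
  have "((\<lambda>t. inverse (f (x(a := t)))) has_field_derivative
      - m a * inverse (f x) / x a) (at (x a))" if "\<forall>a\<in>J. x a \<noteq> 0" "a \<in> J" for x a
  proof -
    have *: "((\<lambda>t. f (x(a := t))) has_field_derivative m a * f x / x a) (at (x a))" "f x \<noteq> 0"
      using assms that unfolding laurent_monomial_def by blast+
    have "f (x(a := x a)) \<noteq> 0" using * by simp
    from DERIV_inverse_fun[OF *(1) this] show ?thesis
      by (rule DERIV_cong) (use * in \<open>simp add: field_simps\<close>)
  qed
  then show ?thesis
    using assms unfolding laurent_monomial_def by auto
qed

fun cell_exponent :: "nat \<Rightarrow> torus_label \<Rightarrow> cell_label \<Rightarrow> complex" where
  "cell_exponent n (d i) a = (let j = (i + n) mod (n + 1) in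
     of_bool (a = A i) + - of_bool (a = A j) + - of_bool (a = D i) + of_bool (a = D j))"
| "cell_exponent n (c i) a = (let j = (i + n) mod (n + 1); k = (i + 1) mod (n + 1) in
     of_bool (a = B i) + of_bool (a = C i)
     + (if j < i then - of_bool (a = A j) else of_bool (a = D j))
     + (if i < k then of_bool (a = A k) else - of_bool (a = D k)))"

lemma cell_map_monomial:
  assumes "l \<in> torus_labels n"
  shows "laurent_monomial (cell_labels n) (cell_exponent n l) (\<lambda>y. cell_map n y l)"
proof -
  have if_mono: "laurent_monomial J (\<lambda>a. if Q then m a else m' a) (\<lambda>x. if Q then f x else g x)"
    if "laurent_monomial J m f" "laurent_monomial J m' g" for J m m' f g Q
    using that by (cases Q) simp_all
  have j: "(i + n) mod (n + 1) \<in> {0..n}" and k: "(i + 1) mod (n + 1) \<in> {0..n}" for i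
    by (simp_all only: mod_le atLeastAtMost_iff le0 simp_thms)
  have "laurent_monomial (cell_labels n) (cell_exponent n (d i)) (cell_d n i)"
    "laurent_monomial (cell_labels n) (cell_exponent n (c i)) (cell_c n i)" if "i \<in> {0..n}" for i
    unfolding cell_d_def cell_c_def cell_exponent.simps Let_def
    using that j[of i] k[of i]
    by (intro laurent_monomial_mult laurent_monomial_inverse laurent_monomial_coord if_mono; blast)+
  then show ?thesis
    using assms by (auto simp: cell_map_def torus_point_simps)
qed

lemma sum_cell_omega:
  "(\<Sum>a\<in>cell_labels n. \<Sum>b\<in>cell_labels n. cell_omega a b * u a * v b)
    = (\<Sum>k=0..n. u (B k) * v (A k) - u (A k) * v (B k) + u (D k) * v (C k) - u (C k) * v (D k))"
proof -
  have split: "(\<Sum>a\<in>cell_labels n. h a) = (\<Sum>k=0..n. h (A k)) + (\<Sum>k=0..n. h (B k))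
      + (\<Sum>k=0..n. h (C k)) + (\<Sum>k=0..n. h (D k))" for h :: "cell_label \<Rightarrow> complex"
  proof -
    have "(\<Sum>a\<in>cell_labels n. h a)
        = sum h (A ` {0..n}) + sum h (B ` {0..n}) + sum h (C ` {0..n}) + sum h (D ` {0..n})"
      by (subst sum.union_disjoint, simp, simp, force)+ simp
    then show ?thesis by (simp add: sum.reindex inj_on_def)
  qed
  have delta: "(\<Sum>j=0..n. of_bool (k = j) * w * h j) = w * h k"
    "(\<Sum>j=0..n. of_bool (j = k) * w * h j) = w * h k" if "k \<le> n" for w k and h :: "nat \<Rightarrow> complex"
    using that by (simp_all add: of_bool_def if_distrib[of "\<lambda>x. x * _"] cong: if_cong)
  show ?thesis
    unfolding split by (simp add: delta sum_negf sum_subtractf sum.distrib)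
qed

text \<open>Since \<open>B\<^sub>k\<close> and \<open>C\<^sub>k\<close> both occur exactly in \<open>c\<^sub>k\<close>, with exponent \<open>1\<close>, only the differences \<open>e\<close> of the
  exponents of \<open>A\<^sub>k\<close> and \<open>D\<^sub>k\<close> matter.  In them the case distinctions of \<open>c\<^sub>i\<close>
  disappear: a neighbour contributes the same, whether through \<open>A\<close> or through \<open>D\<close>.\<close>

lemma cell_exponent_bracket:
  assumes "n \<ge> 1" "l \<in> torus_labels n" "l' \<in> torus_labels n"
  defines "u \<equiv> cell_exponent n l" and "v \<equiv> cell_exponent n l'"
  shows "(\<Sum>k=0..n. u (B k) * v (A k) - u (A k) * v (B k) + u (D k) * v (C k) - u (C k) * v (D k))
    = torus_omega n l l'"
proof -
  define e where "e l k = cell_exponent n l (A k) - cell_exponent n l (D k)" for l k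
  have BC: "cell_exponent n l (B k) = of_bool (l = c k)" "cell_exponent n l (C k) = of_bool (l = c k)" for l k
    by (cases l; auto simp: Let_def)+
  have ed: "e (d i) k = 2 * of_bool (k = i) - 2 * of_bool (k = (i + n) mod (n + 1))" for i k
    by (simp only: e_def cell_exponent.simps Let_def cell_label.inject cell_label.distinct
        of_bool_eq simp_thms) simp
  have ec: "e (c i) k = of_bool (k = (i + 1) mod (n + 1)) - of_bool (k = (i + n) mod (n + 1))"
    if "i \<le> n" for i k
  proof -
    have "(i + n) mod (n + 1) \<noteq> i" "(i + 1) mod (n + 1) \<noteq> i"
      using assms(1) that unfolding mod_pred[OF that] mod_succ[OF that] by auto
    then show ?thesis
      by (simp only: e_def cell_exponent.simps Let_def cell_label.inject cell_label.distinct
        of_bool_eq simp_thms) (simp split: if_splits)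
  qed
  have "(\<Sum>k=0..n. u (B k) * v (A k) - u (A k) * v (B k) + u (D k) * v (C k) - u (C k) * v (D k))
      = (\<Sum>k=0..n. of_bool (l = c k) * e l' k) - (\<Sum>k=0..n. of_bool (l' = c k) * e l k)"
    unfolding u_def v_def BC e_def sum_subtractf[symmetric]
    by (intro sum.cong refl) (simp add: algebra_simps)
  also have "\<dots> = torus_omega n l l'"
  proof -
    have c: "(\<Sum>k=0..n. of_bool (c i = c k) * h k) = h i" if "i \<le> n" for i and h :: "nat \<Rightarrow> complex"
      using that sum_of_bool_eq[OF that, of h] by (simp add: eq_commute[of i])
    have d: "(\<Sum>k=0..n. of_bool (d i = c k) * h k) = 0" for i and h :: "nat \<Rightarrow> complex"
      by simp
    have m: "j = (i + n) mod (n + 1) \<longleftrightarrow> i = (j + 1) mod (n + 1)" if "i \<le> n" "j \<le> n" for i j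
      using mod_succ_eq_iff[OF that(2,1)] by simp
    show ?thesis
    proof (cases l; cases l')
      fix i j assume *: "l = c i" "l' = c j"
      then have le: "i \<le> n" "j \<le> n" using assms(2,3) by auto
      show ?thesis unfolding * c[OF le(1)] c[OF le(2)] ec[OF le(1)] ec[OF le(2)]
          m[OF le] m[OF le(2,1)] torus_omega.simps by simp
    next
      fix i j assume *: "l = c i" "l' = d j"
      then have le: "i \<le> n" "j \<le> n" using assms(2,3) by auto
      show ?thesis unfolding * c[OF le(1)] d ed m[OF le(2,1)] torus_omega.simps by (simp add: eq_commute)
    next
      fix i j assume *: "l = d i" "l' = c j"
      then have le: "i \<le> n" "j \<le> n" using assms(2,3) by auto
      show ?thesis unfolding * c[OF le(2)] d ed m[OF le] torus_omega.simps by (simp add: eq_commute)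
    next
      fix i j assume *: "l = d i" "l' = d j"
      show ?thesis unfolding * d torus_omega.simps by simp
    qed
  qed
  finally show ?thesis .
qed

lemma cell_map_in_points:
  assumes "y \<in> points (cell_coords n)"
  shows "cell_map n y \<in> points (poisson_torus n)"
proof -
  have "\<forall>a\<in>cell_labels n. y a \<noteq> 0" using assms by (auto simp: points_cell PiE_iff)
  then have "cell_map n y l \<noteq> 0" if "l \<in> torus_labels n" for l
    using cell_map_monomial[OF that] unfolding laurent_monomial_def by blast
  then show ?thesis
    by (auto simp: points_poisson_torus cell_map_def torus_point_def PiE_iff)
qed

lemma cell_map_is_poisson:
  assumes "n \<ge> 1"
  shows "poisson_map (cell_coords n) (poisson_torus n) (cell_map n)"
proof -
  have LP: "(\<lambda>y. f (cell_map n y)) \<in> laurent_polys (cell_labels n)"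
    if "f \<in> laurent_polys (torus_labels n)" for f
    using cell_map_monomial unfolding laurent_monomial_def
    by (intro laurent_polys_compose[OF that]) blast+
  have "f \<circ> cell_map n \<in> funs (cell_coords n)" if f: "f \<in> funs (poisson_torus n)" for f
    using f LP cell_map_in_points unfolding funs_poisson_torus funs_cell by fastforce
  moreover have "bracket (cell_coords n) (f \<circ> cell_map n) (g \<circ> cell_map n) y
      = bracket (poisson_torus n) f g (cell_map n y)"
    if f: "f \<in> funs (poisson_torus n)" and g: "g \<in> funs (poisson_torus n)"
      and y: "y \<in> points (cell_coords n)" for f g y
  proof -
    obtain f' where f': "f' \<in> laurent_polys (torus_labels n)"
      "\<And>x. x \<in> points (poisson_torus n) \<Longrightarrow> f x = f' x"
      using f by (auto simp: funs_poisson_torus)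
    obtain g' where g': "g' \<in> laurent_polys (torus_labels n)"
      "\<And>x. x \<in> points (poisson_torus n) \<Longrightarrow> g x = g' x"
      using g by (auto simp: funs_poisson_torus)
    have nz: "\<forall>a\<in>cell_labels n. y a \<noteq> 0" using y by (auto simp: points_cell PiE_iff)
    have "bracket (cell_coords n) (f \<circ> cell_map n) (g \<circ> cell_map n) y
        = coord_bracket (cell_labels n) (\<lambda>a b x. cell_omega a b * x a * x b)
            (f' \<circ> cell_map n) (g' \<circ> cell_map n) y"
      unfolding bracket_cell
      using f'(2) g'(2) cell_map_in_points y unfolding points_cell
      by (intro coord_bracket_local_cong[OF _ _ open_nonzero]) auto
    also have "\<dots> = coord_bracket (torus_labels n) (\<lambda>a b x. torus_omega n a b * x a * x b) f' g' (cell_map n y)"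
    proof (rule coord_bracket_pullback[OF _ f'(1) g'(1)])
      show "cell_map n y l \<noteq> 0" if "l \<in> torus_labels n" for l
        using cell_map_monomial[OF that] nz unfolding laurent_monomial_def by blast
      show "((\<lambda>t. cell_map n (y(a := t)) l) has_field_derivative
           cell_exponent n l a * cell_map n y l / y a) (at (y a))"
        if "l \<in> torus_labels n" "a \<in> cell_labels n" for l a
        using cell_map_monomial[OF that(1)] nz that(2) unfolding laurent_monomial_def by blast
      show "(\<Sum>a\<in>cell_labels n. \<Sum>b\<in>cell_labels n. cell_omega a b * y a * y b
           * (cell_exponent n l a * cell_map n y l / y a) * (cell_exponent n l' b * cell_map n y l' / y b))
          = torus_omega n l l' * cell_map n y l * cell_map n y l'"
        if l: "l \<in> torus_labels n" "l' \<in> torus_labels n" for l l'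
      proof -
        have "(\<Sum>a\<in>cell_labels n. \<Sum>b\<in>cell_labels n. cell_omega a b * y a * y b
           * (cell_exponent n l a * cell_map n y l / y a) * (cell_exponent n l' b * cell_map n y l' / y b))
          = (\<Sum>a\<in>cell_labels n. \<Sum>b\<in>cell_labels n. cell_omega a b * cell_exponent n l a * cell_exponent n l' b)
              * (cell_map n y l * cell_map n y l')"
          unfolding sum_distrib_right using nz by (intro sum.cong refl) simp
        then show ?thesis
          unfolding sum_cell_omega cell_exponent_bracket[OF assms l] by simp
      qed
    qed auto
    also have "\<dots> = bracket (poisson_torus n) f g (cell_map n y)"
      unfolding bracket_poisson_torus
      using f'(2) g'(2) cell_map_in_points[OF y] unfolding points_poisson_torus
      by (intro coord_bracket_local_cong[OF _ _ open_nonzero]) auto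
    finally show ?thesis .
  qed
  ultimately show ?thesis
    unfolding poisson_map_def using cell_map_in_points by auto
qed

text \<open>The values \<open>d\<^sub>i = t\<^sub>i / t\<^sub>i\<^sub>-\<^sub>1\<close> multiply to \<open>1\<close> around the cycle.  Conversely, partial products of
  the \<open>d\<^sub>i\<close> serve as \<open>A\<^sub>i\<close>; with \<open>C\<^sub>i = D\<^sub>i = 1\<close>, the factor \<open>B\<^sub>i\<close> is free to adjust \<open>c\<^sub>i\<close>.\<close>

lemma cell_map_image:
  assumes n: "n \<ge> 1"
  shows "cell_map n ` points (cell_coords n) = {x \<in> points (poisson_torus n). (\<Prod>i=0..n. x (d i)) = 1}"
proof (intro equalityI subsetI)
  fix x assume "x \<in> cell_map n ` points (cell_coords n)"
  then obtain y where y: "y \<in> points (cell_coords n)" and x: "x = cell_map n y" by auto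
  note nz = cell_point_nonzero[OF y]
  define t where "t i = y (A i) * inverse (y (D i))" for i
  have t: "t i \<noteq> 0" if "i \<le> n" for i using nz[OF that] by (simp add: t_def)
  have "(\<Prod>i=0..n. x (d i)) = (\<Prod>i=0..n. t i * inverse (t ((i + n) mod (n + 1))))"
    by (intro prod.cong refl) (simp add: x cell_map_def torus_point_simps cell_d_def Let_def t_def mult_ac)
  also have "\<dots> = (\<Prod>i=0..n. t i) * inverse (\<Prod>i=0..n. t ((i + n) mod (n + 1)))"
    by (simp only: prod.distrib prod_inversef[symmetric] o_def)
  also have "(\<Prod>i=0..n. t ((i + n) mod (n + 1))) = (\<Prod>i=0..n. t i)"
    by (rule prod.reindex_bij_betw[OF bij_betw_mod_pred])
  also have "(\<Prod>i=0..n. t i) * inverse (\<Prod>i=0..n. t i) = 1" using t by simp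
  finally show "x \<in> {x \<in> points (poisson_torus n). (\<Prod>i=0..n. x (d i)) = 1}"
    using cell_map_in_points[OF y] by (simp add: x)
next
  fix x assume "x \<in> {x \<in> points (poisson_torus n). (\<Prod>i=0..n. x (d i)) = 1}"
  then have x: "x \<in> points (poisson_torus n)" and prod: "(\<Prod>i=0..n. x (d i)) = 1" by auto
  have nz: "x (c i) \<noteq> 0" "x (d i) \<noteq> 0" if "i \<le> n" for i
    using that x by (auto simp: points_poisson_torus PiE_iff)
  (* the normalization t 0 = 1; d_0 is then recovered from the product condition *)
  define t where "t i = (\<Prod>k\<in>{1..i}. x (d k))" for i
  have t: "t i \<noteq> 0" if "i \<le> n" for i using nz that by (simp add: t_def)
  have t_ratio: "t i * inverse (t ((i + n) mod (n + 1))) = x (d i)" if i: "i \<le> n" for i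
  proof (cases "i = 0")
    case True
    have "x (d 0) * t n = 1"
      using prod by (simp add: t_def prod.atLeast_Suc_atMost)
    then have "inverse (t n) = x (d 0)" by (simp add: inverse_unique mult.commute)
    then show ?thesis using True by (simp add: t_def)
  next
    case False
    then obtain m where m: "i = Suc m" using not0_implies_Suc by blast
    have "t i = t m * x (d i)" by (simp add: t_def m)
    moreover have "(i + n) mod (n + 1) = m" unfolding mod_pred[OF i] using m by simp
    ultimately show ?thesis using t[of m] i m by simp
  qed
  (* r i is the part of the monomial c_i that involves A and D, evaluated at A = t and D = 1 *)
  define r where "r i = (if (i + n) mod (n + 1) < i then inverse (t ((i + n) mod (n + 1))) else 1)
    * (if i < (i + 1) mod (n + 1) then t ((i + 1) mod (n + 1)) else 1)" for i
  have r: "r i \<noteq> 0" if "i \<le> n" for i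
    using t[OF mod_le] by (simp add: r_def)
  define y where "y = (\<lambda>a \<in> cell_labels n. case a of
     A i \<Rightarrow> t i | B i \<Rightarrow> x (c i) * inverse (r i) | C i \<Rightarrow> 1 | D i \<Rightarrow> 1)"
  have yv: "y (A i) = t i" "y (B i) = x (c i) * inverse (r i)" "y (C i) = 1" "y (D i) = 1" if "i \<le> n" for i
    using that by (simp_all add: y_def)
  have "y \<in> points (cell_coords n)"
    using t r nz by (auto simp: points_cell y_def)
  moreover have "x = cell_map n y"
    unfolding cell_map_def
  proof (rule eq_torus_pointI[OF x])
    fix i assume i: "i \<le> n"
    show "x (d i) = cell_d n i y"
      unfolding cell_d_def Let_def yv[OF i] yv[OF mod_le] using t_ratio[OF i] by simp
    have "cell_c n i y = x (c i) * inverse (r i) * r i"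
      unfolding cell_c_def Let_def yv[OF i] yv[OF mod_le] r_def by simp
    then show "x (c i) = cell_c n i y" using r[OF i] by simp
  qed
  ultimately show "x \<in> cell_map n ` points (cell_coords n)" by blast
qed

section \<open>The Coxeter-Toda system and the common reduction\<close>

lemma points_coxeter: "points (coxeter_toda_space n G \<phi>) = factorization n G \<phi> ` points (cell_coords n)"
  and funs_coxeter: "funs (coxeter_toda_space n G \<phi>) = {f. f \<circ> factorization n G \<phi> \<in> funs (cell_coords n)}"
  and bracket_coxeter: "bracket (coxeter_toda_space n G \<phi>) f g x =
    (THE w. \<forall>y\<in>points (cell_coords n). factorization n G \<phi> y = x \<longrightarrow>
      bracket (cell_coords n) (f \<circ> factorization n G \<phi>) (g \<circ> factorization n G \<phi>) y = w)"
  by (simp_all add: coxeter_toda_space_def Let_def)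

lemma funs_cell_cong:
  "f \<in> funs (cell_coords n) \<Longrightarrow> (\<And>y. y \<in> points (cell_coords n) \<Longrightarrow> f y = g y) \<Longrightarrow> g \<in> funs (cell_coords n)"
  by (force simp: funs_cell)

lemma bracket_cell_cong:
  assumes "\<And>y. y \<in> points (cell_coords n) \<Longrightarrow> f y = f' y"
    "\<And>y. y \<in> points (cell_coords n) \<Longrightarrow> g y = g' y" "y \<in> points (cell_coords n)"
  shows "bracket (cell_coords n) f g y = bracket (cell_coords n) f' g' y"
  unfolding bracket_cell using assms unfolding points_cell
  by (intro coord_bracket_local_cong[OF _ _ open_nonzero]) auto

context central_loop_extension
begin

text \<open>The map is defined by a chosen factorization of its argument; by \<open>cell_map_fibre\<close> every other one
  gives the same value.\<close>

lemma coxeter_toda_map_factorization: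
  assumes n: "n \<ge> 1" and y: "y \<in> points (cell_coords n)"
  shows "coxeter_toda_map n G \<phi> (factorization n G \<phi> y) = cell_map n y"
proof -
  let ?x = "factorization n G \<phi> y"
  have "?x \<in> factorization n G \<phi> ` points (cell_coords n)" using y by blast
  then have f: "factors n G \<phi> ?x \<in> points (cell_coords n)" "factorization n G \<phi> (factors n G \<phi> ?x) = ?x"
    unfolding factors_def by (rule inv_into_into, rule f_inv_into_f)
  show ?thesis
    unfolding coxeter_toda_map_eq[OF n f(1)] by (rule cell_map_fibre[OF n f(1) y f(2)])
qed

text \<open>For functions pulled back from the torus, the bracket upstairs takes the same value at all
  factorizations of a point, so that the definite description in the Poisson structure is met.\<close>

lemma coxeter_toda_reduction:
  assumes n: "n \<ge> 1"
  shows "hamiltonian_reduction (coxeter_toda_space n G \<phi>) (coxeter_toda_hamiltonian pr)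
       (poisson_torus n) (H1 n) (coxeter_toda_map n G \<phi>)"
proof -
  let ?F = "coxeter_toda_map n G \<phi>" and ?\<Phi> = "factorization n G \<phi>" and ?M = "coxeter_toda_space n G \<phi>"
  note F = coxeter_toda_map_factorization[OF n]
  note P = cell_map_is_poisson[OF n, unfolded poisson_map_def]
  have points: "?F x \<in> points (poisson_torus n)" if "x \<in> points ?M" for x
    using that F cell_map_in_points by (auto simp: points_coxeter)
  have H: "H1 n (?F x) = coxeter_toda_hamiltonian pr x" if "x \<in> points ?M" for x
    using that F coxeter_toda_hamiltonian_factorization[OF n] by (auto simp: points_coxeter)
  have funs: "f' \<in> funs ?M" if "f \<in> funs (poisson_torus n)" "\<And>x. x \<in> points ?M \<Longrightarrow> f' x = f (?F x)" for f f'
  proof -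
    have "f \<circ> cell_map n \<in> funs (cell_coords n)" using P that(1) by blast
    then have "f' \<circ> ?\<Phi> \<in> funs (cell_coords n)"
      by (rule funs_cell_cong) (simp add: that(2) points_coxeter F)
    then show ?thesis by (simp add: funs_coxeter)
  qed
  have bracket: "bracket ?M f' g' x = bracket (poisson_torus n) f g (?F x)"
    if "f \<in> funs (poisson_torus n)" "g \<in> funs (poisson_torus n)" "x \<in> points ?M"
      "\<And>x. x \<in> points ?M \<Longrightarrow> f' x = f (?F x)" "\<And>x. x \<in> points ?M \<Longrightarrow> g' x = g (?F x)" for f g f' g' x
  proof -
    have *: "bracket (cell_coords n) (f' \<circ> ?\<Phi>) (g' \<circ> ?\<Phi>) y = bracket (poisson_torus n) f g (?F x)"
      if y: "y \<in> points (cell_coords n)" and x: "?\<Phi> y = x" for y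
    proof -
      have "bracket (cell_coords n) (f' \<circ> ?\<Phi>) (g' \<circ> ?\<Phi>) y
          = bracket (cell_coords n) (f \<circ> cell_map n) (g \<circ> cell_map n) y"
        using y by (intro bracket_cell_cong) (simp_all add: \<open>\<And>x. x \<in> points ?M \<Longrightarrow> f' x = f (?F x)\<close>
          \<open>\<And>x. x \<in> points ?M \<Longrightarrow> g' x = g (?F x)\<close> points_coxeter F)
      also have "\<dots> = bracket (poisson_torus n) f g (cell_map n y)"
        using P \<open>f \<in> _\<close> \<open>g \<in> _\<close> y by blast
      finally show ?thesis using F[OF y] x by simp
    qed
    obtain y where "y \<in> points (cell_coords n)" "?\<Phi> y = x"
      using \<open>x \<in> points ?M\<close> by (auto simp: points_coxeter)
    then show ?thesis
      unfolding bracket_coxeter using * by (intro the_equality) auto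
  qed
  show ?thesis
    unfolding hamiltonian_reduction_def poisson_map_def
    using points funs bracket H H1_in_funs[of n] by (auto simp: o_def)
qed

lemma coxeter_toda_map_image:
  assumes n: "n \<ge> 1"
  shows "coxeter_toda_map n G \<phi> ` points (coxeter_toda_space n G \<phi>)
    = {x \<in> points (poisson_torus n). (\<Prod>i=0..n. x (d i)) = 1}"
  unfolding cell_map_image[OF n, symmetric] points_coxeter image_image
  by (rule image_cong[OF refl coxeter_toda_map_factorization[OF n]])

end

theorem proposition5p8:
  fixes n :: nat
    and G :: "('g, 'm) monoid_scheme"
    and pr :: "'g \<Rightarrow> laurent mat"
    and \<phi> :: "nat \<Rightarrow> complex mat \<Rightarrow> 'g"
  assumes "n \<ge> 1"
    and "central_loop_extension n G pr \<phi>"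
  shows
    "hamiltonian_reduction
       (coxeter_toda_space n G \<phi>) (coxeter_toda_hamiltonian pr)
       (poisson_torus n) (H1 n) (coxeter_toda_map n G \<phi>) \<and>
     hamiltonian_reduction
       (toda_space n) (toda_hamiltonian n 2)
       (poisson_torus n) (H1 n) (toda_map n) \<and>
     coxeter_toda_map n G \<phi> ` points (coxeter_toda_space n G \<phi>) =
       {x \<in> points (poisson_torus n). (\<Prod>i=0..n. x (d i)) = 1} \<and>
     toda_map n ` points (toda_space n) =
       {x \<in> points (poisson_torus n). (\<Prod>i=0..n. x (c i)) = 4 ^ (n + 1) * (\<Prod>i=0..n. x (d i))} \<and>
     casimir (poisson_torus n) (\<lambda>x. \<Prod>i=0..n. x (c i)) \<and>
     casimir (poisson_torus n) (\<lambda>x. \<Prod>i=0..n. x (d i))"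
proof -
  interpret central_loop_extension n G pr \<phi> by fact
  show ?thesis
    by (intro conjI coxeter_toda_reduction[OF assms(1)] toda_reduction coxeter_toda_map_image[OF assms(1)]
        toda_map_image casimir_poisson_torus)
qed

end
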